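(* Assume $T$ is NIP, working in a monster model $\mathbb{M}$. Let $X_1,\ldots,X_n$ be definable sets and $Y$ a definable subset of $X_1\times\cdots\times X_n$. Then $Y$ is broad if and only if there exist infinite definable subsets $D_i\subseteq X_i$ ($1\le i\le n$) such that $(D_1\times\cdots\times D_n)\setminus Y$ is a "hyperplane", in the sense that for every $b\in D_n$ the set $$\{(a_1,\ldots,a_{n-1})\in D_1\times\cdots\times D_{n-1} ~|~ (a_1,\ldots,a_{n-1},b)\notin Y\}$$ is narrow as a subset of $X_1\times\cdots\times X_{n-1}$.
   Context: Definable means definable with parameters in the monster model. For definable sets $X_1,\ldots,X_n$ and a type-definable $Y\subseteq X_1\times\cdots\times X_n$, $Y$ is broad if there exist elements $a_{i,j}\in X_i$ for $1\le i\le n$, $j\in\mathbb{N}$, such that for each fixed $i$ the $a_{i,j}$ are pairwise distinct, and for every function $\eta:[n]\to\mathbb{N}$ the tuple $(a_{1,\eta(1)},\ldots,a_{n,\eta(n)})$ lies in $Y$. Otherwise $Y$ is narrow. (For $n-1=0$ the product $X_1\times\cdots\times X_0$ is a one-point set, and a subset of it is broad iff it is nonempty.) *)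

theory Defs
  imports Main "HOL-Library.FuncSet"
begin

unbundle cardinal_syntax

text \<open>Languages carry explicit sets of symbols, so that languages without function symbols
  (or without relation symbols) are covered although HOL types are nonempty.\<close>

record ('f, 'r) language =
  funs :: "'f set"
  rels :: "'r set"
  fun_ar :: "'f \<Rightarrow> nat"
  rel_ar :: "'r \<Rightarrow> nat"

datatype 'f tm = Var nat | App 'f "'f tm list"

datatype ('f, 'r) fm =
    Eq "'f tm" "'f tm"
  | Pred 'r "'f tm list"
  | Neg "('f, 'r) fm"
  | Conj "('f, 'r) fm" "('f, 'r) fm"
  | Ex nat "('f, 'r) fm"

primrec vars_tm :: "'f tm \<Rightarrow> nat set" where
  "vars_tm (Var x) = {x}"
| "vars_tm (App g ts) = \<Union> (set (map vars_tm ts))"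

primrec fv :: "('f, 'r) fm \<Rightarrow> nat set" where
  "fv (Eq s t) = vars_tm s \<union> vars_tm t"
| "fv (Pred r ts) = \<Union> (set (map vars_tm ts))"
| "fv (Neg p) = fv p"
| "fv (Conj p q) = fv p \<union> fv q"
| "fv (Ex x p) = fv p - {x}"

fun is_tm :: "('f, 'r) language \<Rightarrow> 'f tm \<Rightarrow> bool" where
  "is_tm L (Var x) \<longleftrightarrow> True"
| "is_tm L (App g ts) \<longleftrightarrow>
     g \<in> funs L \<and> length ts = fun_ar L g \<and> list_all (is_tm L) ts"

primrec is_fm :: "('f, 'r) language \<Rightarrow> ('f, 'r) fm \<Rightarrow> bool" where
  "is_fm L (Eq s t) \<longleftrightarrow> is_tm L s \<and> is_tm L t"
| "is_fm L (Pred r ts) \<longleftrightarrow> r \<in> rels L \<and> length ts = rel_ar L r \<and> list_all (is_tm L) ts"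
| "is_fm L (Neg p) \<longleftrightarrow> is_fm L p"
| "is_fm L (Conj p q) \<longleftrightarrow> is_fm L p \<and> is_fm L q"
| "is_fm L (Ex x p) \<longleftrightarrow> is_fm L p"

text \<open>The universe of a structure is the whole type \<open>'a\<close>. Values of the interpretation at symbols
  outside the language, or at lists of the wrong length, never matter for formulas of the
  language.\<close>

record ('f, 'r, 'a) struct =
  fun_int :: "'f \<Rightarrow> 'a list \<Rightarrow> 'a"
  rel_int :: "'r \<Rightarrow> 'a list \<Rightarrow> bool"

primrec eval_tm :: "('f, 'r, 'a) struct \<Rightarrow> (nat \<Rightarrow> 'a) \<Rightarrow> 'f tm \<Rightarrow> 'a" where
  "eval_tm M e (Var x) = e x"
| "eval_tm M e (App g ts) = fun_int M g (map (eval_tm M e) ts)"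

primrec sat :: "('f, 'r, 'a) struct \<Rightarrow> (nat \<Rightarrow> 'a) \<Rightarrow> ('f, 'r) fm \<Rightarrow> bool" where
  "sat M e (Eq s t) \<longleftrightarrow> eval_tm M e s = eval_tm M e t"
| "sat M e (Pred r ts) \<longleftrightarrow> rel_int M r (map (eval_tm M e) ts)"
| "sat M e (Neg p) \<longleftrightarrow> \<not> sat M e p"
| "sat M e (Conj p q) \<longleftrightarrow> sat M e p \<and> sat M e q"
| "sat M e (Ex x p) \<longleftrightarrow> (\<exists>a. sat M (e(x := a)) p)"

text \<open>\<open>holds M p c\<close> evaluates \<open>p(v\<^sub>0, \<dots>, v\<^sub>k)\<close> at a tuple \<open>c\<close>; it is only used for formulas in
  \<open>fms L (length c)\<close>, so entries of \<open>c\<close> out of range are irrelevant.\<close>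

definition fms :: "('f, 'r) language \<Rightarrow> nat \<Rightarrow> ('f, 'r) fm set" where
  "fms L k = {p. is_fm L p \<and> fv p \<subseteq> {..<k}}"

definition holds :: "('f, 'r, 'a) struct \<Rightarrow> ('f, 'r) fm \<Rightarrow> 'a list \<Rightarrow> bool" where
  "holds M p c \<longleftrightarrow> sat M (\<lambda>i. c ! i) p"

definition Th :: "('f, 'r) language \<Rightarrow> ('f, 'r, 'a) struct \<Rightarrow> ('f, 'r) fm set" where
  "Th L M = {p \<in> fms L 0. holds M p []}"

text \<open>Saturation is stated for (partial) 1-types over small parameter sets; in a pair \<open>(p, c)\<close> the
  variable \<open>v\<^sub>0\<close> of \<open>p\<close> is the variable of the type and \<open>c\<close> is the tuple of parameters.\<close>

definition saturated ::
  "('f, 'r) language \<Rightarrow> 'k rel \<Rightarrow> ('f, 'r, 'a) struct \<Rightarrow> bool" where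
  "saturated L \<kappa> M \<longleftrightarrow>
     (\<forall>A \<Phi>. ( |A| <o \<kappa> \<and>
             \<Phi> \<subseteq> {(p, c). p \<in> fms L (Suc (length c)) \<and> set c \<subseteq> A} \<and>
             (\<forall>\<Phi>'. \<Phi>' \<subseteq> \<Phi> \<and> finite \<Phi>' \<longrightarrow> (\<exists>x. \<forall>(p, c) \<in> \<Phi>'. holds M p (x # c)))) \<longrightarrow>
            (\<exists>x. \<forall>(p, c) \<in> \<Phi>. holds M p (x # c)))"

definition partial_elementary ::
  "('f, 'r) language \<Rightarrow> ('f, 'r, 'a) struct \<Rightarrow> 'a set \<Rightarrow> ('a \<Rightarrow> 'a) \<Rightarrow> bool" where
  "partial_elementary L M A h \<longleftrightarrow>
     (\<forall>c p. set c \<subseteq> A \<and> p \<in> fms L (length c) \<longrightarrow> (holds M p c \<longleftrightarrow> holds M p (map h c)))"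

definition automorphism ::
  "('f, 'r) language \<Rightarrow> ('f, 'r, 'a) struct \<Rightarrow> ('a \<Rightarrow> 'a) \<Rightarrow> bool" where
  "automorphism L M \<sigma> \<longleftrightarrow> bij \<sigma> \<and>
     (\<forall>g \<in> funs L. \<forall>c. length c = fun_ar L g \<longrightarrow> \<sigma> (fun_int M g c) = fun_int M g (map \<sigma> c)) \<and>
     (\<forall>r \<in> rels L. \<forall>c. length c = rel_ar L r \<longrightarrow> (rel_int M r c \<longleftrightarrow> rel_int M r (map \<sigma> c)))"

definition strongly_homogeneous ::
  "('f, 'r) language \<Rightarrow> 'k rel \<Rightarrow> ('f, 'r, 'a) struct \<Rightarrow> bool" where
  "strongly_homogeneous L \<kappa> M \<longleftrightarrow>
     (\<forall>A h. |A| <o \<kappa> \<and> partial_elementary L M A h \<longrightarrow>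
            (\<exists>\<sigma>. automorphism L M \<sigma> \<and> (\<forall>a \<in> A. \<sigma> a = h a)))"

text \<open>A monster model of the complete theory \<open>T\<close>, with ``small'' meaning ``of cardinality
  less than \<open>\<kappa>\<close>''. A complete theory is identified with its deductive closure, which is the set of
  sentences true in any one of its models. The only largeness demanded of \<open>\<kappa>\<close> is
  \<open>\<kappa> > |L| + \<aleph>\<^sub>0\<close>, so every usual convention on the size of the monster is covered.\<close>

definition monster_model ::
  "('f, 'r) language \<Rightarrow> ('f, 'r) fm set \<Rightarrow> 'k rel \<Rightarrow> ('f, 'r, 'a) struct \<Rightarrow> bool" where
  "monster_model L T \<kappa> M \<longleftrightarrow>
     T = Th L M \<and>
     Card_order \<kappa> \<and> natLeq <o \<kappa> \<and> |funs L| <o \<kappa> \<and> |rels L| <o \<kappa> \<and>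
     saturated L \<kappa> M \<and> strongly_homogeneous L \<kappa> M"

text \<open>The independence property of \<open>p(x; y)\<close> with \<open>x\<close> the first \<open>k\<close> and \<open>y\<close> the next \<open>l\<close>
  variables.\<close>

definition has_IP :: "('f, 'r, 'a) struct \<Rightarrow> ('f, 'r) fm \<Rightarrow> nat \<Rightarrow> nat \<Rightarrow> bool" where
  "has_IP M p k l \<longleftrightarrow>
     (\<exists>(a :: nat \<Rightarrow> 'a list) (b :: nat set \<Rightarrow> 'a list).
        (\<forall>i. length (a i) = k) \<and> (\<forall>S. length (b S) = l) \<and>
        (\<forall>i S. holds M p (a i @ b S) \<longleftrightarrow> i \<in> S))"

text \<open>A theory is NIP if no formula has the independence property in a model of it. HOL cannot
  quantify over all types, so the models are those with universe \<open>'a\<close>. If \<open>T\<close> is complete and has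
  a monster model with universe \<open>'a\<close>, nothing is lost: if a formula has the independence property
  in some model of \<open>T\<close>, it has it in the monster.\<close>

definition NIP :: "'a itself \<Rightarrow> ('f, 'r) language \<Rightarrow> ('f, 'r) fm set \<Rightarrow> bool" where
  "NIP _ L T \<longleftrightarrow>
     (\<forall>M :: ('f, 'r, 'a) struct. (\<forall>s \<in> T. holds M s []) \<longrightarrow>
        (\<forall>k l. \<forall>p \<in> fms L (k + l). \<not> has_IP M p k l))"

definition definable ::
  "('f, 'r) language \<Rightarrow> ('f, 'r, 'a) struct \<Rightarrow> nat \<Rightarrow> 'a list set \<Rightarrow> bool" where
  "definable L M k D \<longleftrightarrow>
     (\<exists>c. \<exists>p \<in> fms L (k + length c). D = {x. length x = k \<and> holds M p (x @ c)})"

text \<open>If \<open>X i\<close> consists of tuples of length \<open>m i\<close>, then elements of \<open>X\<^sub>1 \<times> \<dots> \<times> X\<^sub>n\<close>, rendered as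
  \<open>Pi\<^sub>E {1..n} X\<close>, are tuples of tuples; flattening identifies them with tuples of length
  \<open>m 1 + \<dots> + m n\<close>.\<close>

definition flatten :: "nat \<Rightarrow> (nat \<Rightarrow> 'a list) \<Rightarrow> 'a list" where
  "flatten n f = concat (map f [1..<Suc n])"

definition definable_in_prod ::
  "('f, 'r) language \<Rightarrow> ('f, 'r, 'a) struct \<Rightarrow> nat \<Rightarrow> (nat \<Rightarrow> nat) \<Rightarrow> (nat \<Rightarrow> 'a list) set \<Rightarrow> bool"
  where
  "definable_in_prod L M n m Y \<longleftrightarrow> definable L M (\<Sum>i = 1..n. m i) (flatten n ` Y)"

definition broad :: "nat \<Rightarrow> (nat \<Rightarrow> 'b set) \<Rightarrow> (nat \<Rightarrow> 'b) set \<Rightarrow> bool" where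
  "broad n X Y \<longleftrightarrow>
     (\<exists>a :: nat \<Rightarrow> nat \<Rightarrow> 'b.
        (\<forall>i \<in> {1..n}. (\<forall>j. a i j \<in> X i) \<and> inj (a i)) \<and>
        (\<forall>\<eta> :: nat \<Rightarrow> nat. (\<lambda>i \<in> {1..n}. a i (\<eta> i)) \<in> Y))"

abbreviation narrow :: "nat \<Rightarrow> (nat \<Rightarrow> 'b set) \<Rightarrow> (nat \<Rightarrow> 'b) set \<Rightarrow> bool" where
  "narrow n X Y \<equiv> \<not> broad n X Y"

end

theory Submission
  imports Defs "HOL-Library.Countable_Set_Type" "HOL-Library.Ramsey"
begin

text \<open>By saturation a definable set is broad iff it contains finite grids of every size, so Ramsey's
  theorem for finite products shows that narrow definable sets form an ideal; a hyperplane is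
  narrow because a grid in it would give a grid in one of its fibres. This settles the direction
  from right to left.

  Conversely, suppose that \<open>Y\<close> is broad. By induction on \<open>n\<close> it suffices to find a broad definable
  \<open>W\<close> in the first \<open>n - 1\<close> coordinates such that \<open>W\<close> minus the fibre \<open>Y\<^sub>b\<close> contains no grid of some
  fixed size, for infinitely many \<open>b\<close>: boxes for \<open>W\<close> together with these \<open>b\<close> are the required
  sets. Suppose there is no such \<open>W\<close>. By NIP no \<open>N\<close> fibres are shattered, and by Ramsey's theorem
  one may assume that a single pattern in \<open>2\<^sup>N\<close> is omitted by all increasing \<open>N\<close>-tuples from a
  sequence of \<open>b\<close>'s. All of its fibres meet in a broad set, and since no \<open>W\<close> exists one can insert
  fibres to be avoided one after the other, keeping the intersection broad. In this way every
  pattern in \<open>2\<^sup>N\<close> is realised, a contradiction.\<close>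

section \<open>Definable predicates and saturation\<close>

primrec rename_tm :: "(nat \<Rightarrow> nat) \<Rightarrow> 'f tm \<Rightarrow> 'f tm" where
  "rename_tm f (Var x) = Var (f x)"
| "rename_tm f (App g ts) = App g (map (rename_tm f) ts)"

lemma vars_rename_tm: "vars_tm (rename_tm f t) = f ` vars_tm t"
  by (induction t) auto

lemma is_tm_rename_tm: "is_tm L (rename_tm f t) \<longleftrightarrow> is_tm L t"
  by (induction t) (auto simp: list_all_iff)

lemma eval_rename_tm: "eval_tm M e (rename_tm f t) = eval_tm M (\<lambda>i. e (f i)) t"
proof (induction t)
  case (App g ts)
  then have "map (eval_tm M e) (map (rename_tm f) ts) = map (eval_tm M (\<lambda>i. e (f i))) ts" by auto
  then show ?case by (metis eval_tm.simps(2) rename_tm.simps(2))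
qed simp

lemma eval_tm_cong: "(\<And>x. x \<in> vars_tm t \<Longrightarrow> e x = e' x) \<Longrightarrow> eval_tm M e t = eval_tm M e' t"
proof (induction t)
  case (App g ts)
  then have "map (eval_tm M e) ts = map (eval_tm M e') ts" by auto
  then show ?case by (metis eval_tm.simps(2))
qed simp

lemma sat_cong: "(\<And>x. x \<in> fv p \<Longrightarrow> e x = e' x) \<Longrightarrow> sat M e p \<longleftrightarrow> sat M e' p"
proof (induction p arbitrary: e e')
  case (Eq s t)
  then have "eval_tm M e s = eval_tm M e' s" "eval_tm M e t = eval_tm M e' t"
    by (auto intro: eval_tm_cong)
  then show ?case by simp
next
  case (Pred r ts)
  then have "map (eval_tm M e) ts = map (eval_tm M e') ts"
    by (auto intro!: eval_tm_cong)
  then show ?case by (metis sat.simps(2))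
next
  case (Neg p)
  then show ?case by (metis fv.simps(3) sat.simps(3))
next
  case (Conj p q)
  then show ?case by (metis UnI1 UnI2 fv.simps(4) sat.simps(4))
next
  case (Ex x p)
  have "sat M (e(x := a)) p \<longleftrightarrow> sat M (e'(x := a)) p" for a
    by (rule Ex.IH) (use Ex.prems in auto)
  then show ?case by simp
qed

lemma finite_vars_tm: "finite (vars_tm t)"
  by (induction t) auto

lemma finite_fv: "finite (fv p)"
  by (induction p) (auto simp: finite_vars_tm)

text \<open>Renaming may force bound variables to change, so the new formula is obtained by
  existence rather than by recursion. The map \<open>f\<close> may identify variables; this is used
  later to merge them.\<close>

lemma rename_fm:
  assumes "is_fm L p"
  shows "\<exists>p'. is_fm L p' \<and> fv p' \<subseteq> f ` fv p \<and> (\<forall>e. sat M e p' \<longleftrightarrow> sat M (\<lambda>i. e (f i)) p)"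
  using assms
proof (induction p arbitrary: f)
  case (Eq s t)
  then show ?case
    by (intro exI[of _ "Eq (rename_tm f s) (rename_tm f t)"])
      (auto simp: vars_rename_tm is_tm_rename_tm eval_rename_tm)
next
  case (Pred r ts)
  then show ?case
    by (intro exI[of _ "Pred r (map (rename_tm f) ts)"])
      (auto simp: vars_rename_tm is_tm_rename_tm eval_rename_tm list_all_iff comp_def)
next
  case (Neg p)
  then obtain p' where "is_fm L p'" "fv p' \<subseteq> f ` fv p" "\<forall>e. sat M e p' \<longleftrightarrow> sat M (\<lambda>i. e (f i)) p"
    by (metis is_fm.simps(3))
  then show ?case by (intro exI[of _ "Neg p'"]) auto
next
  case (Conj p q)
  then obtain p' q' where "is_fm L p'" "fv p' \<subseteq> f ` fv p" "\<forall>e. sat M e p' \<longleftrightarrow> sat M (\<lambda>i. e (f i)) p"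
    "is_fm L q'" "fv q' \<subseteq> f ` fv q" "\<forall>e. sat M e q' \<longleftrightarrow> sat M (\<lambda>i. e (f i)) q"
    by (metis is_fm.simps(4))
  then show ?case by (intro exI[of _ "Conj p' q'"]) auto
next
  case (Ex x p)
  \<comment> \<open>A bound variable fresh for the renamed free variables, so nothing is
    captured.\<close>
  obtain y where y: "y \<notin> f ` fv p"
    using finite_fv[of p] by (metis finite_imageI ex_new_if_finite infinite_UNIV_nat)
  obtain p' where p': "is_fm L p'" "fv p' \<subseteq> (f(x := y)) ` fv p"
    "\<forall>e. sat M e p' \<longleftrightarrow> sat M (\<lambda>i. e ((f(x := y)) i)) p"
    using Ex by (metis is_fm.simps(5))
  have "sat M (e(y := a)) p' \<longleftrightarrow> sat M ((\<lambda>i. e (f i))(x := a)) p" for e a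
    unfolding p'(3)[rule_format] by (rule sat_cong) (use y in auto)
  then show ?case using p'(1,2) by (intro exI[of _ "Ex y p'"]) auto
qed

lemma ex_list_fm:
  assumes "is_fm L p"
  shows "\<exists>p'. is_fm L p' \<and> (\<forall>e. sat M e p' \<longleftrightarrow> (\<exists>e'. (\<forall>i. i \<notin> set vs \<longrightarrow> e' i = e i) \<and> sat M e' p))"
proof (induction vs)
  case Nil
  show ?case using assms by (intro exI[of _ p]) (simp add: fun_eq_iff[symmetric])
next
  case (Cons v vs)
  then obtain p' where p': "is_fm L p'"
    "\<forall>e. sat M e p' \<longleftrightarrow> (\<exists>e'. (\<forall>i. i \<notin> set vs \<longrightarrow> e' i = e i) \<and> sat M e' p)" by blast
  have "(\<exists>a. sat M (e(v := a)) p') \<longleftrightarrow> (\<exists>e'. (\<forall>i. i \<notin> set (v # vs) \<longrightarrow> e' i = e i) \<and> sat M e' p)" for e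
  proof
    assume "\<exists>a. sat M (e(v := a)) p'"
    then obtain a e' where "\<forall>i. i \<notin> set vs \<longrightarrow> e' i = (e(v := a)) i" "sat M e' p"
      unfolding p'(2)[rule_format] by blast
    then show "\<exists>e'. (\<forall>i. i \<notin> set (v # vs) \<longrightarrow> e' i = e i) \<and> sat M e' p"
      by (intro exI[of _ e']) auto
  next
    assume "\<exists>e'. (\<forall>i. i \<notin> set (v # vs) \<longrightarrow> e' i = e i) \<and> sat M e' p"
    then obtain e' where "\<forall>i. i \<notin> set (v # vs) \<longrightarrow> e' i = e i" "sat M e' p" by blast
    then have "\<exists>e''. (\<forall>i. i \<notin> set vs \<longrightarrow> e'' i = (e(v := e' v)) i) \<and> sat M e'' p"
      by (intro exI[of _ e']) auto
    then show "\<exists>a. sat M (e(v := a)) p'"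
      unfolding p'(2)[rule_format] by blast
  qed
  then show ?case using p'(1) by (intro exI[of _ "Ex v p'"]) simp
qed

section \<open>Definability with parameters, over arbitrary types of variables\<close>

locale saturated_structure =
  fixes L :: "('f, 'r) language" and \<kappa> :: "'k rel" and M :: "('f, 'r, 'a) struct"
  assumes uncountable: "natLeq <o \<kappa>" and saturated: "saturated L \<kappa> M"
begin

text \<open>Each variable \<open>v\<^sub>i\<close> of a formula is assigned a variable of an arbitrary type \<open>'v\<close> or a parameter
  from the structure. This makes substitution of variables and parameters trivial.\<close>

definition env_definable :: "(('v \<Rightarrow> 'a) \<Rightarrow> bool) \<Rightarrow> bool" where
  "env_definable Q \<longleftrightarrow> (\<exists>p g. is_fm L p \<and> (\<forall>e. Q e \<longleftrightarrow> sat M (\<lambda>i. case_sum e id (g i)) p))"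

lemma env_definable_neg: "env_definable Q \<Longrightarrow> env_definable (\<lambda>e. \<not> Q e)"
  unfolding env_definable_def by (metis is_fm.simps(3) sat.simps(3))

text \<open>The variables of the two formulas are moved to even and odd numbers, so that the
  assignments \<open>g\<close> and \<open>h\<close> combine into one.\<close>

lemma env_definable_conj:
  assumes "env_definable Q" "env_definable R"
  shows "env_definable (\<lambda>e. Q e \<and> R e)"
proof -
  obtain p g where p: "is_fm L p" "\<And>e. Q e \<longleftrightarrow> sat M (\<lambda>i. case_sum e id (g i)) p"
    using assms(1) unfolding env_definable_def by blast
  obtain q h where q: "is_fm L q" "\<And>e. R e \<longleftrightarrow> sat M (\<lambda>i. case_sum e id (h i)) q"
    using assms(2) unfolding env_definable_def by blast
  obtain p' where p': "is_fm L p'" "\<And>e. sat M e p' \<longleftrightarrow> sat M (\<lambda>i. e (2 * i)) p"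
    using rename_fm[OF p(1)] by blast
  obtain q' where q': "is_fm L q'" "\<And>e. sat M e q' \<longleftrightarrow> sat M (\<lambda>i. e (Suc (2 * i))) q"
    using rename_fm[OF q(1), where f = "\<lambda>i. Suc (2 * i)"] by blast
  let ?g = "\<lambda>i. if even i then g (i div 2) else h (i div 2)"
  show ?thesis
    unfolding env_definable_def
    by (intro exI[of _ "Conj p' q'"] exI[of _ ?g]) (use p' q' p q in auto)
qed

lemma env_definable_reindex:
  assumes "env_definable Q"
  shows "env_definable (\<lambda>e. Q (\<lambda>v. case_sum e id (h v)))"
proof -
  obtain p g where p: "is_fm L p" "\<And>e. Q e \<longleftrightarrow> sat M (\<lambda>i. case_sum e id (g i)) p"
    using assms(1) unfolding env_definable_def by blast
  have "(\<lambda>i. case_sum (\<lambda>v. case_sum e id (h v)) id (g i)) =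
      (\<lambda>i. case_sum e id (case_sum h Inr (g i)))" for e
    by (auto split: sum.splits)
  then show ?thesis
    unfolding env_definable_def p(2) using p(1) by (intro exI[of _ p] exI[of _ "\<lambda>i. case_sum h Inr (g i)"]) auto
qed

text \<open>The quantifier binds a whole environment, possibly infinite; a formula only looks at finitely
  many of its entries.\<close>

lemma env_definable_exs:
  assumes "env_definable (\<lambda>e. P (\<lambda>v. e (Inl v)) (\<lambda>u. e (Inr u)))"
  shows "env_definable (\<lambda>e. \<exists>e'. P e e')"
proof -
  obtain p g where p: "is_fm L p"
    "\<And>e. P (\<lambda>v. e (Inl v)) (\<lambda>u. e (Inr u)) \<longleftrightarrow> sat M (\<lambda>i. case_sum e id (g i)) p"
    using assms(1) unfolding env_definable_def by blast
  \<comment> \<open>\<open>I\<close> collects the free variables assigned to a quantified entry.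
    Several may carry the same entry; \<open>f\<close> merges them into a least representative, so
    that quantifying over the variables in \<open>I\<close> gives them a common value.\<close>
  define I where "I = {i \<in> fv p. \<exists>u. g i = Inl (Inr u)}"
  define f where "f = (\<lambda>i. if i \<in> I then LEAST j. j \<in> I \<and> g j = g i else i)"
  have f: "f i \<in> I \<and> g (f i) = g i" if "i \<in> I" for i
    using LeastI[of "\<lambda>j. j \<in> I \<and> g j = g i" i] that by (simp add: f_def)
  obtain q where q: "is_fm L q" "\<And>e. sat M e q \<longleftrightarrow> sat M (\<lambda>i. e (f i)) p"
    using rename_fm[OF p(1)] by blast
  have "finite I" by (simp add: I_def finite_fv)
  then obtain vs where vs: "set vs = I" using finite_list by blast
  obtain r where r: "is_fm L r"
    "\<And>e. sat M e r \<longleftrightarrow> (\<exists>e'. (\<forall>i. i \<notin> set vs \<longrightarrow> e' i = e i) \<and> sat M e' q)"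
    using ex_list_fm[OF q(1)] by blast
  \<comment> \<open>The default \<open>undefined\<close> is harmless: at indices in \<open>I\<close>
    the quantifiers of \<open>r\<close> override it, and indices outside \<open>fv p\<close> do not
    affect the truth value.\<close>
  define h where "h = (\<lambda>i. case g i of Inl (Inl v) \<Rightarrow> Inl v | Inl (Inr u) \<Rightarrow> Inr undefined | Inr a \<Rightarrow> Inr a)"
  have main: "(\<exists>e'. P e e') \<longleftrightarrow> sat M (\<lambda>i. case_sum e id (h i)) r" for e
  proof
    assume "\<exists>e'. P e e'"
    then obtain e' where "P e e'" by blast
    then have "sat M (\<lambda>i. case_sum (case_sum e e') id (g i)) p"
      using p(2)[of "case_sum e e'"] by simp
    moreover define d where "d = (\<lambda>i. if i \<in> I then case_sum (case_sum e e') id (g i) else case_sum e id (h i))"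
    have "d (f i) = case_sum (case_sum e e') id (g i)" if "i \<in> fv p" for i
    proof (cases "i \<in> I")
      case True
      then show ?thesis using f by (simp add: d_def)
    next
      case False
      then show ?thesis using that by (auto simp: d_def f_def h_def I_def split: sum.splits)
    qed
    ultimately have "sat M (\<lambda>i. d (f i)) p"
      using sat_cong[of p "\<lambda>i. d (f i)" "\<lambda>i. case_sum (case_sum e e') id (g i)" M] by blast
    then show "sat M (\<lambda>i. case_sum e id (h i)) r"
      unfolding r(2) q(2) by (intro exI[of _ d]) (auto simp: d_def vs)
  next
    assume "sat M (\<lambda>i. case_sum e id (h i)) r"
    then obtain d where d: "\<And>i. i \<notin> I \<Longrightarrow> d i = case_sum e id (h i)" "sat M (\<lambda>i. d (f i)) p"
      unfolding r(2) q(2) vs by blast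
    define e' where "e' = (\<lambda>u. d (LEAST j. j \<in> I \<and> g j = Inl (Inr u)))"
    have "d (f i) = case_sum (case_sum e e') id (g i)" if "i \<in> fv p" for i
    proof (cases "i \<in> I")
      case True
      then obtain u where "g i = Inl (Inr u)" by (auto simp: I_def)
      then show ?thesis using True by (simp add: e'_def f_def)
    next
      case False
      then show ?thesis using that d(1)[OF False] by (auto simp: f_def h_def I_def split: sum.splits)
    qed
    then have "sat M (\<lambda>i. case_sum (case_sum e e') id (g i)) p"
      using d(2) sat_cong[of p "\<lambda>i. d (f i)" "\<lambda>i. case_sum (case_sum e e') id (g i)" M] by blast
    then show "\<exists>e'. P e e'" using p(2)[of "case_sum e e'"] by auto
  qed
  show ?thesis unfolding env_definable_def using main r(1) by blast
qed

lemma env_definable_eq: "env_definable (\<lambda>e. e v = e w)"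
  unfolding env_definable_def
  by (intro exI[of _ "Eq (Var 0) (Var 1)"] exI[of _ "\<lambda>i. if i = 0 then Inl v else Inl w"]) auto

lemma env_definable_True: "env_definable (\<lambda>e. True)"
  unfolding env_definable_def by (intro exI[of _ "Eq (Var 0) (Var 0)"]) auto

lemma env_definable_holds:
  assumes "p \<in> fms L (length vs + length c)"
  shows "env_definable (\<lambda>e. holds M p (map e vs @ c))"
proof -
  have "sat M (\<lambda>i. (map e vs @ c) ! i) p \<longleftrightarrow>
    sat M (\<lambda>i. case_sum e id (if i < length vs then Inl (vs ! i) else Inr (c ! (i - length vs)))) p" for e
    by (rule sat_cong) (use assms in \<open>auto simp: fms_def nth_append\<close>)
  then show ?thesis using assms unfolding env_definable_def holds_def fms_def
    by (intro exI[of _ p] exI[of _ "\<lambda>i. if i < length vs then Inl (vs ! i) else Inr (c ! (i - length vs))"]) simp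
qed

lemma env_definable_finite_support:
  assumes "env_definable Q"
  shows "\<exists>V. finite V \<and> (\<forall>e e'. (\<forall>v \<in> V. e v = e' v) \<longrightarrow> Q e = Q e')"
proof -
  obtain p g where p: "is_fm L p" "\<And>e. Q e \<longleftrightarrow> sat M (\<lambda>i. case_sum e id (g i)) p"
    using assms(1) unfolding env_definable_def by blast
  define V where "V = {v. \<exists>i \<in> fv p. g i = Inl v}"
  have "V \<subseteq> (\<lambda>i. projl (g i)) ` fv p" by (force simp: V_def)
  then have "finite V" using finite_fv finite_surj by blast
  moreover have "Q e = Q e'" if "\<forall>v \<in> V. e v = e' v" for e e'
    unfolding p(2) by (rule sat_cong) (use that in \<open>auto simp: V_def split: sum.splits\<close>)
  ultimately show ?thesis by blast
qed

text \<open>This leads back to formulas with a list of parameters: variables in \<open>vs\<close>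
  come first, and any other free variable \<open>i\<close> becomes slot
  \<open>length vs + i\<close>. Assigned variables outside \<open>vs\<close> are fixed at
  \<open>undefined\<close>, as \<open>supp\<close> permits.\<close>

lemma holds_if_env_definable:
  assumes "env_definable Q" and supp: "\<And>e e'. (\<And>v. v \<in> set vs \<Longrightarrow> e v = e' v) \<Longrightarrow> Q e = Q e'"
  shows "\<exists>c. \<exists>p \<in> fms L (length vs + length c). \<forall>e. holds M p (map e vs @ c) \<longleftrightarrow> Q e"
proof -
  obtain p g where p: "is_fm L p" "\<And>e. Q e \<longleftrightarrow> sat M (\<lambda>i. case_sum e id (g i)) p"
    using assms(1) unfolding env_definable_def by blast
  obtain B where B: "fv p \<subseteq> {..<B}"
    using finite_fv[of p] by (metis finite_nat_iff_bounded)
  have "\<forall>v. \<exists>i. v \<in> set vs \<longrightarrow> i < length vs \<and> vs ! i = v"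
    by (auto simp: in_set_conv_nth)
  then obtain idx where idx: "\<And>v. v \<in> set vs \<Longrightarrow> idx v < length vs \<and> vs ! idx v = v"
    by metis
  define c where "c = map (\<lambda>i. case g i of Inl v \<Rightarrow> undefined | Inr a \<Rightarrow> a) [0..<B]"
  define f where "f = (\<lambda>i. case g i of Inl v \<Rightarrow> if v \<in> set vs then idx v else length vs + i | Inr a \<Rightarrow> length vs + i)"
  obtain q where q: "is_fm L q" "fv q \<subseteq> f ` fv p" "\<And>e. sat M e q \<longleftrightarrow> sat M (\<lambda>i. e (f i)) p"
    using rename_fm[OF p(1)] by blast
  have lc: "length c = B" by (simp add: c_def)
  have "f i < length vs + B" if "i \<in> fv p" for i
    using that B idx by (fastforce simp: f_def split: sum.splits)
  then have "q \<in> fms L (length vs + length c)"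
    using q(1,2) lc by (auto simp: fms_def)
  moreover have "holds M q (map e vs @ c) \<longleftrightarrow> Q e" for e
  proof -
    define e' where "e' = (\<lambda>v. if v \<in> set vs then e v else undefined)"
    have "Q e = Q e'" by (rule supp) (simp add: e'_def)
    moreover have "sat M (\<lambda>i. (map e vs @ c) ! f i) p \<longleftrightarrow> sat M (\<lambda>i. case_sum e' id (g i)) p"
    proof (rule sat_cong)
      fix i assume "i \<in> fv p"
      then have "i < B" using B by auto
      then show "(map e vs @ c) ! f i = case_sum e' id (g i)"
        using idx by (auto simp: f_def e'_def c_def nth_append split: sum.splits)
    qed
    ultimately show ?thesis unfolding holds_def q(3) p(2) by blast
  qed
  ultimately show ?thesis by blast
qed

text \<open>Countably many formulas mention only countably many parameters, and
  \<open>\<kappa>\<close> is uncountable, so saturation for 1-types applies. Initial segments stand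
  for finite sets of conditions.\<close>

lemma countably_saturated:
  fixes Q :: "nat \<Rightarrow> (unit \<Rightarrow> 'a) \<Rightarrow> bool"
  assumes Q: "\<And>t. env_definable (Q t)" and sat: "\<And>N. \<exists>e. \<forall>t<N. Q t e"
  shows "\<exists>e. \<forall>t. Q t e"
proof -
  have "\<exists>c. \<exists>p \<in> fms L (Suc (length c)). \<forall>e. holds M p (e () # c) \<longleftrightarrow> Q t e" for t
  proof -
    have "\<exists>c. \<exists>p \<in> fms L (length [()] + length c). \<forall>e. holds M p (map e [()] @ c) \<longleftrightarrow> Q t e"
    proof (rule holds_if_env_definable[OF Q])
      fix e e' :: "unit \<Rightarrow> 'a"
      assume "\<And>v. v \<in> set [()] \<Longrightarrow> e v = e' v"
      then have "e = e'" by (auto simp: fun_eq_iff)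
      then show "Q t e = Q t e'" by simp
    qed
    then show ?thesis by simp
  qed
  then obtain c p where cp: "\<And>t. p t \<in> fms L (Suc (length (c t)))"
    "\<And>t e. holds M (p t) (e () # c t) \<longleftrightarrow> Q t e" by metis
  define A where "A = (\<Union>t. set (c t))"
  have "countable A" by (simp add: A_def countable_finite)
  then have "|A| \<le>o natLeq"
    using countable_card_le_natLeq by blast
  then have "|A| <o \<kappa>" using uncountable ordLeq_ordLess_trans by blast
  moreover define \<Phi> where "\<Phi> = range (\<lambda>t. (p t, c t))"
  have "\<Phi> \<subseteq> {(p, c). p \<in> fms L (Suc (length c)) \<and> set c \<subseteq> A}"
    using cp(1) by (auto simp: \<Phi>_def A_def)
  moreover have "\<exists>x. \<forall>(p, c) \<in> \<Phi>'. holds M p (x # c)" if fin: "\<Phi>' \<subseteq> \<Phi>" "finite \<Phi>'" for \<Phi>'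
  proof -
    obtain I where I: "finite I" "\<Phi>' = (\<lambda>t. (p t, c t)) ` I"
      using finite_subset_image[of \<Phi>' "\<lambda>t. (p t, c t)" UNIV] fin unfolding \<Phi>_def by blast
    obtain N where "I \<subseteq> {..<N}" using I(1) finite_nat_iff_bounded by blast
    moreover obtain e where "\<forall>t<N. Q t e" using sat by blast
    ultimately have "\<forall>t \<in> I. holds M (p t) (e () # c t)" using cp(2) by auto
    then show ?thesis using I(2) by auto
  qed
  ultimately have "\<exists>x. \<forall>(p, c) \<in> \<Phi>. holds M p (x # c)"
    using saturated[unfolded saturated_def, rule_format, of A \<Phi>] by blast
  then obtain x where "\<And>t. holds M (p t) (x # c t)" by (auto simp: \<Phi>_def)
  then show ?thesis using cp(2)[of _ "\<lambda>_. x"] by blast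
qed

lemma env_definable_rename: "env_definable Q \<Longrightarrow> env_definable (\<lambda>e. Q (\<lambda>v. e (h v)))"
  using env_definable_reindex[of Q "\<lambda>v. Inl (h v)"] by simp

lemma env_definable_eq_const: "env_definable (\<lambda>e. e v = c)"
  using env_definable_reindex[OF env_definable_eq[of True False], of "\<lambda>b. if b then Inl v else Inr c"] by simp

lemma env_definable_ball:
  assumes "finite I" "\<And>i. i \<in> I \<Longrightarrow> env_definable (Q i)"
  shows "env_definable (\<lambda>e. \<forall>i \<in> I. Q i e)"
  using assms by (induction I rule: finite_induct) (simp_all add: env_definable_True env_definable_conj)

text \<open>The entries are chosen one at a time, so that every finite set of conditions stays
  satisfiable by some continuation. The limit works because each condition depends on finitely many
  entries only.\<close>

lemma saturation_nat:
  fixes Q :: "nat \<Rightarrow> (nat \<Rightarrow> 'a) \<Rightarrow> bool"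
  assumes Q: "\<And>t. env_definable (Q t)" and sat: "\<And>N. \<exists>e. \<forall>t<N. Q t e"
  shows "\<exists>e. \<forall>t. Q t e"
proof -
  define ext where "ext = (\<lambda>k e. \<forall>N. \<exists>e'. (\<forall>i<k. e' i = e i) \<and> (\<forall>t<N. Q t e'))"
  have step: "\<exists>a. ext (Suc k) (e(k := a))" if "ext k e" for k e
  proof -
    \<comment> \<open>All entries except \<open>k\<close> are quantified away, and those already
      chosen act as parameters. An element satisfying every \<open>S N\<close> is a legitimate next
      entry.\<close>
    define S where "S = (\<lambda>N (x :: unit \<Rightarrow> 'a). \<exists>e'. (\<forall>i \<in> {..<k}. e' i = e i) \<and> e' k = x () \<and> (\<forall>t \<in> {..<N}. Q t e'))"
    have "env_definable (S N)" for N
      unfolding S_def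
      by (rule env_definable_exs) (intro env_definable_conj env_definable_ball env_definable_eq env_definable_eq_const env_definable_rename[OF Q] finite_lessThan)
    moreover have "\<exists>x. \<forall>t<N. S t x" for N
    proof -
      have "\<exists>e'. (\<forall>i<k. e' i = e i) \<and> (\<forall>t<N. Q t e')"
        using that unfolding ext_def by (rule spec)
      then obtain e' where "\<forall>i<k. e' i = e i" "\<forall>t<N. Q t e'" by (elim exE conjE)
      then have "S t (\<lambda>_. e' k)" if "t < N" for t
        unfolding S_def using that by (intro exI[of _ e']) auto
      then show ?thesis by blast
    qed
    ultimately obtain x where "\<And>N. S N x" using countably_saturated[of S] by blast
    then have "ext (Suc k) (e(k := x ()))"
      unfolding ext_def S_def by (auto simp: less_Suc_eq) (metis lessThan_iff)
    then show ?thesis by blast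
  qed
  have "ext 0 (\<lambda>_. undefined)" using sat by (auto simp: ext_def)
  then have "\<exists>f. \<forall>k. ext k (f k) \<and> (\<forall>i<k. f (Suc k) i = f k i)"
    using dependent_nat_choice[of "\<lambda>k e. ext k e" "\<lambda>k e e'. \<forall>i<k. e' i = e i"] step
    by (metis fun_upd_other less_irrefl)
  then obtain f where f: "\<And>k. ext k (f k)" "\<And>k i. i < k \<Longrightarrow> f (Suc k) i = f k i" by blast
  define e where "e = (\<lambda>i. f (Suc i) i)"
  have "f (k + Suc i) i = e i" for i k
    by (induction k) (auto simp: e_def f(2))
  then have fe: "f k i = e i" if "i < k" for i k
    using that by (metis Suc_leI add.commute le_Suc_ex)
  have "Q t e" for t
  proof -
    obtain V where V: "finite V" "\<And>e e'. (\<And>v. v \<in> V \<Longrightarrow> e v = e' v) \<Longrightarrow> Q t e = Q t e'"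
      using env_definable_finite_support[OF Q] by metis
    obtain k where k: "V \<subseteq> {..<k}" using V(1) by (metis finite_nat_iff_bounded)
    obtain e' where e': "\<forall>i<k. e' i = f k i" "Q t e'"
      using f(1)[of k] unfolding ext_def by (metis lessI)
    have "Q t e = Q t e'" by (rule V(2)) (use k e'(1) fe in auto)
    then show ?thesis using e'(2) by blast
  qed
  then show ?thesis by blast
qed

lemma saturation:
  fixes Q :: "nat \<Rightarrow> ('v :: countable \<Rightarrow> 'a) \<Rightarrow> bool"
  assumes "\<And>t. env_definable (Q t)" and sat: "\<And>N. \<exists>e. \<forall>t<N. Q t e"
  shows "\<exists>e. \<forall>t. Q t e"
proof -
  have "\<exists>e. \<forall>t<N. Q t (\<lambda>v. e (to_nat v))" for N
  proof -
    obtain e where e: "\<forall>t<N. Q t e" using sat by blast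
    then show ?thesis by (intro exI[of _ "\<lambda>i. e (from_nat i)"]) simp
  qed
  then show ?thesis using saturation_nat[of "\<lambda>t e. Q t (\<lambda>v. e (to_nat v))"] assms(1) env_definable_rename by blast
qed

text \<open>In \<open>tuple_definable s Q\<close> the variable \<open>w\<close> ranges over tuples of length \<open>s w\<close>.\<close>

definition tup :: "('w \<Rightarrow> nat) \<Rightarrow> ('w \<times> nat \<Rightarrow> 'a) \<Rightarrow> 'w \<Rightarrow> 'a list" where
  "tup s e w = map (\<lambda>t. e (w, t)) [0..<s w]"

definition tuple_definable :: "('w \<Rightarrow> nat) \<Rightarrow> (('w \<Rightarrow> 'a list) \<Rightarrow> bool) \<Rightarrow> bool" where
  "tuple_definable s Q \<longleftrightarrow> env_definable (\<lambda>e. Q (tup s e))"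

lemma length_tup [simp]: "length (tup s e w) = s w"
  by (simp add: tup_def)

lemma tup_surj:
  assumes "\<And>w. length (E w) = s w"
  obtains e where "E = tup s e"
proof
  show "E = tup s (\<lambda>(w, t). E w ! t)"
    by (rule ext) (simp add: tup_def assms[symmetric] map_nth)
qed

lemma tuple_definable_neg: "tuple_definable s Q \<Longrightarrow> tuple_definable s (\<lambda>E. \<not> Q E)"
  unfolding tuple_definable_def by (rule env_definable_neg)

lemma tuple_definable_conj: "tuple_definable s Q \<Longrightarrow> tuple_definable s R \<Longrightarrow> tuple_definable s (\<lambda>E. Q E \<and> R E)"
  unfolding tuple_definable_def by (rule env_definable_conj)

lemma tuple_definable_imp: "tuple_definable s Q \<Longrightarrow> tuple_definable s R \<Longrightarrow> tuple_definable s (\<lambda>E. Q E \<longrightarrow> R E)"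
  using tuple_definable_neg[OF tuple_definable_conj[OF _ tuple_definable_neg]] by simp

lemma tuple_definable_ball: "finite I \<Longrightarrow> (\<And>i. i \<in> I \<Longrightarrow> tuple_definable s (Q i)) \<Longrightarrow> tuple_definable s (\<lambda>E. \<forall>i \<in> I. Q i E)"
  unfolding tuple_definable_def by (rule env_definable_ball)

lemma tuple_definable_const: "tuple_definable s (\<lambda>E. P)"
  using env_definable_True env_definable_neg[OF env_definable_True] by (cases P) (simp_all add: tuple_definable_def)

lemma tuple_definable_iff_const: "tuple_definable s Q \<Longrightarrow> tuple_definable s (\<lambda>E. Q E = P)"
  using tuple_definable_neg by (cases P) simp_all

lemma tuple_definable_reindex:
  assumes "tuple_definable s' Q" "\<And>w'. case h w' of Inl w \<Rightarrow> s w = s' w' | Inr c \<Rightarrow> length c = s' w'"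
  shows "tuple_definable s (\<lambda>E. Q (\<lambda>w'. case_sum E id (h w')))"
proof -
  define h' where "h' = (\<lambda>(w', t). case h w' of Inl w \<Rightarrow> Inl (w, t) | Inr c \<Rightarrow> Inr (c ! t))"
  have "tup s' (\<lambda>v. case_sum e id (h' v)) w' = case_sum (tup s e) id (h w')" for e w'
    using assms(2)[of w'] by (auto simp: tup_def h'_def map_nth split: sum.splits) (metis map_nth)
  then have "tup s' (\<lambda>v. case_sum e id (h' v)) = (\<lambda>w'. case_sum (tup s e) id (h w'))" for e
    by (rule ext)
  then show ?thesis using env_definable_reindex[OF assms(1)[unfolded tuple_definable_def], of h'] unfolding tuple_definable_def by simp
qed

lemma tuple_definable_rename:
  assumes "tuple_definable s' Q" "\<And>w'. s (h w') = s' w'"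
  shows "tuple_definable s (\<lambda>E. Q (\<lambda>w'. E (h w')))"
  using tuple_definable_reindex[OF assms(1), where h = "\<lambda>w'. Inl (h w')" and s = s] assms(2) by simp

text \<open>Prescribing the lengths turns a quantifier over lists into one over their entries, which
  \<open>env_definable_exs\<close> handles.\<close>

lemma tuple_definable_exs:
  fixes s :: "'w \<Rightarrow> nat" and s' :: "'u \<Rightarrow> nat"
  assumes "tuple_definable (case_sum s s') (\<lambda>E. P (\<lambda>w. E (Inl w)) (\<lambda>u. E (Inr u)))"
  shows "tuple_definable s (\<lambda>E. \<exists>F. (\<forall>u. length (F u) = s' u) \<and> P E F)"
proof -
  have "(\<exists>F. (\<forall>u. length (F u) = s' u) \<and> P E F) \<longleftrightarrow> (\<exists>f. P E (tup s' f))" for E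
    by (metis length_tup tup_surj)
  moreover define h :: "('w + 'u) \<times> nat \<Rightarrow> 'w \<times> nat + 'u \<times> nat"
    where "h = (\<lambda>(w, t). case w of Inl w \<Rightarrow> Inl (w, t) | Inr w \<Rightarrow> Inr (w, t))"
  have "(\<lambda>w. tup (case_sum s s') (\<lambda>v. e (h v)) (Inl w)) = tup s (\<lambda>v. e (Inl v))"
    "(\<lambda>w. tup (case_sum s s') (\<lambda>v. e (h v)) (Inr w)) = tup s' (\<lambda>v. e (Inr v))" for e
    by (auto simp: tup_def h_def)
  then have "env_definable (\<lambda>e. P (tup s (\<lambda>v. e (Inl v))) (tup s' (\<lambda>v. e (Inr v))))"
    using env_definable_rename[OF assms[unfolded tuple_definable_def], of h] by simp
  ultimately show ?thesis unfolding tuple_definable_def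
    using env_definable_exs[of "\<lambda>e f. P (tup s e) (tup s' f)"] by simp
qed

lemma tuple_saturation:
  fixes Q :: "nat \<Rightarrow> ('w :: countable \<Rightarrow> 'a list) \<Rightarrow> bool"
  assumes "\<And>t. tuple_definable s (Q t)" and "\<And>N. \<exists>E. (\<forall>w. length (E w) = s w) \<and> (\<forall>t<N. Q t E)"
  shows "\<exists>E. (\<forall>w. length (E w) = s w) \<and> (\<forall>t. Q t E)"
proof -
  have "\<exists>e. \<forall>t<N. Q t (tup s e)" for N
    using assms(2)[of N] by (metis tup_surj)
  then have "\<exists>e. \<forall>t. Q t (tup s e)"
    using saturation[of "\<lambda>t e. Q t (tup s e)"] assms(1) unfolding tuple_definable_def by blast
  then show ?thesis by (metis length_tup)
qed

lemma tuple_definable_eq: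
  assumes "s w = s w'"
  shows "tuple_definable s (\<lambda>E. E w = E w')"
proof -
  have "tup s e w = tup s e w' \<longleftrightarrow> (\<forall>t \<in> {..<s w}. e (w, t) = e (w', t))" for e
    using assms by (auto simp: tup_def)
  then show ?thesis unfolding tuple_definable_def by (simp add: env_definable_ball env_definable_eq)
qed

lemma tuple_definable_definable:
  assumes "definable L M (s w) D"
  shows "tuple_definable s (\<lambda>E. E w \<in> D)"
proof -
  obtain c p where p: "p \<in> fms L (s w + length c)" "D = {x. length x = s w \<and> holds M p (x @ c)}"
    using assms unfolding definable_def by blast
  have "tup s e w \<in> D \<longleftrightarrow> holds M p (map e (map (Pair w) [0..<s w]) @ c)" for e
    by (simp add: p(2) tup_def comp_def)
  moreover have "env_definable (\<lambda>e. holds M p (map e (map (Pair w) [0..<s w]) @ c))"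
    by (rule env_definable_holds) (simp add: p(1))
  ultimately show ?thesis unfolding tuple_definable_def by simp
qed

lemma definable_if_tuple_definable:
  assumes "tuple_definable (\<lambda>_ :: unit. k) (\<lambda>E. Q (E ()))"
  shows "definable L M k {x. length x = k \<and> Q x}"
proof -
  let ?vs = "map (Pair ()) [0..<k]"
  have tup: "tup (\<lambda>_. k) e () = map e ?vs" for e by (simp add: tup_def comp_def)
  have "\<exists>c. \<exists>p \<in> fms L (length ?vs + length c). \<forall>e. holds M p (map e ?vs @ c) \<longleftrightarrow> Q (tup (\<lambda>_. k) e ())"
  proof (rule holds_if_env_definable)
    fix e e' :: "unit \<times> nat \<Rightarrow> 'a"
    assume "\<And>v. v \<in> set ?vs \<Longrightarrow> e v = e' v"
    then have "map e ?vs = map e' ?vs" by (rule map_cong[OF refl])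
    then show "Q (tup (\<lambda>_. k) e ()) = Q (tup (\<lambda>_. k) e' ())" by (simp only: tup)
  qed (use assms in \<open>simp add: tuple_definable_def\<close>)
  then obtain c p where p: "p \<in> fms L (k + length c)"
    "\<And>e. holds M p (map e ?vs @ c) \<longleftrightarrow> Q (map e ?vs)"
    unfolding tup by auto
  have "holds M p (x @ c) \<longleftrightarrow> Q x" if "length x = k" for x
  proof -
    have "map (\<lambda>(_, t). x ! t) ?vs = x" using map_nth[of x] that by (simp add: comp_def)
    then show ?thesis using p(2)[of "\<lambda>(_, t). x ! t"] by simp
  qed
  then show ?thesis unfolding definable_def using p(1) by blast
qed

end

section \<open>Flattened tuples of tuples\<close>

lemma concat_inj:
  assumes "concat (map f xs) = concat (map g xs)" "\<And>x. x \<in> set xs \<Longrightarrow> length (f x) = length (g x)"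
  shows "\<forall>x \<in> set xs. f x = g x"
  using assms by (induction xs) auto

lemma flatten_inj:
  assumes "flatten n f = flatten n g" "\<And>i. i \<in> {1..n} \<Longrightarrow> length (f i) = length (g i)" "i \<in> {1..n}"
  shows "f i = g i"
proof -
  have set: "set [1..<Suc n] = {1..n}" by auto
  have "\<forall>i \<in> set [1..<Suc n]. f i = g i"
    by (rule concat_inj) (use assms(1,2) in \<open>simp_all only: flatten_def set\<close>)
  then show ?thesis using assms(3) unfolding set by (rule bspec)
qed

text \<open>These are the variables in the order in which \<open>flatten\<close> lists the
  entries.\<close>

definition block :: "(nat \<Rightarrow> nat) \<Rightarrow> nat list \<Rightarrow> (nat \<times> nat) list" where
  "block m is = concat (map (\<lambda>i. map (Pair i) [0..<m i]) is)"

lemma set_block: "set (block m is) = {(i, t). i \<in> set is \<and> t < m i}"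
  by (auto simp: block_def)

lemma length_block: "length (block m [1..<Suc n]) = (\<Sum>i = 1..n. m i)"
  by (simp only: block_def length_concat map_map comp_def length_map length_upt minus_nat.diff_0
      interv_sum_list_conv_sum_set_nat set_upt atLeastLessThanSuc_atLeastAtMost)

context saturated_structure
begin

lemma map_block: "map e (block m is) = concat (map (tup m e) is)"
  by (induction "is") (simp_all add: block_def tup_def)

text \<open>Since the component lengths are prescribed, \<open>flatten\<close> is injective on the
  tuples concerned, so membership in the flattened image decides membership in
  \<open>Y\<close>.\<close>

lemma tuple_definable_prod:
  assumes "definable_in_prod L M n m Y" "Y \<subseteq> extensional {1..n}"
    "\<And>f i. f \<in> Y \<Longrightarrow> i \<in> {1..n} \<Longrightarrow> length (f i) = m i"
  shows "tuple_definable m (\<lambda>E. (\<lambda>i \<in> {1..n}. E i) \<in> Y)"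
proof -
  let ?vs = "block m [1..<Suc n]"
  obtain c p where p: "p \<in> fms L (length ?vs + length c)"
    "flatten n ` Y = {x. length x = length ?vs \<and> holds M p (x @ c)}"
    using assms(1) unfolding definable_in_prod_def definable_def length_block[symmetric] by blast
  have "holds M p (map e ?vs @ c) \<longleftrightarrow> (\<lambda>i \<in> {1..n}. tup m e i) \<in> Y" for e
  proof -
    have fl: "map e ?vs = flatten n (\<lambda>i \<in> {1..n}. tup m e i)"
      by (auto simp: map_block flatten_def intro!: arg_cong[where f = concat])
    have "holds M p (map e ?vs @ c) \<longleftrightarrow> map e ?vs \<in> flatten n ` Y" using p(2) by auto
    also have "\<dots> \<longleftrightarrow> (\<lambda>i \<in> {1..n}. tup m e i) \<in> Y"
    proof
      assume "map e ?vs \<in> flatten n ` Y"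
      then obtain f where f: "f \<in> Y" "flatten n (\<lambda>i \<in> {1..n}. tup m e i) = flatten n f"
        using fl by auto
      have "(\<lambda>i \<in> {1..n}. tup m e i) = f"
      proof (rule extensionalityI[of _ "{1..n}"])
        show "f \<in> extensional {1..n}" using f(1) assms(2) by blast
        show "(\<lambda>i \<in> {1..n}. tup m e i) i = f i" if "i \<in> {1..n}" for i
          by (rule flatten_inj[OF f(2) _ that]) (use assms(3)[OF f(1)] in auto)
      qed auto
      then show "(\<lambda>i \<in> {1..n}. tup m e i) \<in> Y" using f(1) by simp
    qed (use fl in auto)
    finally show ?thesis .
  qed
  then show ?thesis using env_definable_holds[OF p(1)] unfolding tuple_definable_def by simp
qed

end

section \<open>Grids\<close>

text \<open>A finite corner of an array as in \<open>broad\<close>. All index sets are finite, so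
  that being a grid is a first-order condition. For \<open>n = 0\<close> a grid of any size, even
  \<open>0\<close>, just says that the one point lies in \<open>W\<close>.\<close>

definition is_grid :: "nat \<Rightarrow> (nat \<Rightarrow> 'b set) \<Rightarrow> (nat \<Rightarrow> 'b) set \<Rightarrow> nat \<Rightarrow> (nat \<Rightarrow> nat \<Rightarrow> 'b) \<Rightarrow> bool"
  where
  "is_grid n X W k a \<longleftrightarrow>
     (\<forall>i \<in> {1..n}. (\<forall>j \<in> {..<k}. a i j \<in> X i) \<and> inj_on (a i) {..<k}) \<and>
     (\<forall>\<eta> \<in> Pi\<^sub>E {1..n} (\<lambda>_. {..<k}). (\<lambda>i \<in> {1..n}. a i (\<eta> i)) \<in> W)"

definition has_grid :: "nat \<Rightarrow> (nat \<Rightarrow> 'b set) \<Rightarrow> (nat \<Rightarrow> 'b) set \<Rightarrow> nat \<Rightarrow> bool" where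
  "has_grid n X W k \<longleftrightarrow> (\<exists>a. is_grid n X W k a)"

lemma is_grid_mono:
  assumes "is_grid n X W k a" "k' \<le> k" "W \<subseteq> W'"
  shows "is_grid n X W' k' a"
proof -
  have "Pi\<^sub>E {1..n} (\<lambda>_. {..<k'}) \<subseteq> Pi\<^sub>E {1..n} (\<lambda>_. {..<k})"
    by (rule PiE_mono) (use assms(2) in auto)
  moreover have "inj_on (a i) {..<k'}" if "i \<in> {1..n}" for i
    using assms(1,2) that inj_on_subset[of "a i" "{..<k}" "{..<k'}"] by (auto simp: is_grid_def)
  ultimately show ?thesis using assms unfolding is_grid_def by (auto simp: subset_iff)
qed

lemma has_grid_mono: "has_grid n X W k \<Longrightarrow> k' \<le> k \<Longrightarrow> W \<subseteq> W' \<Longrightarrow> has_grid n X W' k'"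
  unfolding has_grid_def using is_grid_mono by blast

lemma is_grid_cong:
  assumes "is_grid n X W k a" and eq: "\<And>i j. i \<in> {1..n} \<Longrightarrow> j < k \<Longrightarrow> a' i j = a i j"
  shows "is_grid n X W k a'"
  unfolding is_grid_def
proof (intro conjI ballI)
  fix i assume i: "i \<in> {1..n}"
  show "a' i j \<in> X i" if "j \<in> {..<k}" for j
    using assms(1) i that eq[OF i] by (simp add: is_grid_def)
  have "inj_on (a i) {..<k}" using assms(1) i by (simp add: is_grid_def)
  then show "inj_on (a' i) {..<k}"
    by (rule inj_on_cong[THEN iffD1, rotated]) (simp add: eq[OF i])
next
  fix \<eta> assume \<eta>: "\<eta> \<in> Pi\<^sub>E {1..n} (\<lambda>_. {..<k})"
  have "(\<lambda>i \<in> {1..n}. a' i (\<eta> i)) = (\<lambda>i \<in> {1..n}. a i (\<eta> i))"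
  proof (rule restrict_ext)
    fix i assume "i \<in> {1..n}"
    then show "a' i (\<eta> i) = a i (\<eta> i)" using PiE_mem[OF \<eta>] by (intro eq) auto
  qed
  then show "(\<lambda>i \<in> {1..n}. a' i (\<eta> i)) \<in> W" using assms(1) \<eta> by (simp add: is_grid_def)
qed

lemma broad_imp_is_grid:
  fixes X :: "nat \<Rightarrow> 'b set"
  assumes "broad n X W"
  shows "\<exists>a. \<forall>k. is_grid n X W k a"
proof -
  obtain a :: "nat \<Rightarrow> nat \<Rightarrow> 'b" where "\<forall>i \<in> {1..n}. (\<forall>j. a i j \<in> X i) \<and> inj (a i)"
    "\<forall>\<eta>. (\<lambda>i \<in> {1..n}. a i (\<eta> i)) \<in> W"
    using assms unfolding broad_def by (elim exE conjE)
  then show ?thesis unfolding is_grid_def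
    by (intro exI[of _ a]) (auto intro: inj_on_subset)
qed

lemma broad_imp_has_grid: "broad n X W \<Longrightarrow> has_grid n X W k"
  using broad_imp_is_grid unfolding has_grid_def by blast

text \<open>A choice function takes finitely many values on \<open>{1..n}\<close>, hence stays
  within a finite corner of the array.\<close>

lemma is_grid_imp_broad:
  assumes "\<And>k. is_grid n X W k a"
  shows "broad n X W"
  unfolding broad_def
proof (intro exI[of _ a] conjI ballI allI)
  fix i assume i: "i \<in> {1..n}"
  show "a i j \<in> X i" for j
    using assms[of "Suc j"] i by (auto simp: is_grid_def)
  show "inj (a i)"
  proof (rule injI)
    fix x y assume "a i x = a i y"
    moreover have "inj_on (a i) {..<Suc (max x y)}"
      using assms[of "Suc (max x y)"] i by (simp add: is_grid_def)
    ultimately show "x = y" by (auto dest: inj_onD simp: less_Suc_eq_le)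
  qed
next
  fix \<eta> :: "nat \<Rightarrow> nat"
  \<comment> \<open>\<open>insert 0\<close> keeps \<open>Max\<close> meaningful for
    \<open>n = 0\<close>.\<close>
  define k where "k = Suc (Max (insert 0 (\<eta> ` {1..n})))"
  have "restrict \<eta> {1..n} \<in> Pi\<^sub>E {1..n} (\<lambda>_. {..<k})"
    by (auto simp: k_def less_Suc_eq_le intro!: Max_ge)
  then have "(\<lambda>i \<in> {1..n}. a i (restrict \<eta> {1..n} i)) \<in> W"
    using assms[of k] unfolding is_grid_def by blast
  also have "(\<lambda>i \<in> {1..n}. a i (restrict \<eta> {1..n} i)) = (\<lambda>i \<in> {1..n}. a i (\<eta> i))"
    by (rule restrict_ext) simp
  finally show "(\<lambda>i \<in> {1..n}. a i (\<eta> i)) \<in> W" .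
qed

lemma broad_mono: "broad n X W \<Longrightarrow> W \<subseteq> W' \<Longrightarrow> broad n X W'"
  unfolding broad_def by blast

section \<open>Ramsey theorems for products and for increasing tuples\<close>

lemma pigeonhole_fibre:
  assumes "finite P" "h ` {..<R} \<subseteq> P" "card P * k < R"
  shows "\<exists>x \<in> P. k \<le> card {b \<in> {..<R}. h b = x}"
proof (rule ccontr)
  assume neg: "\<not> ?thesis"
  have "(\<Union>x \<in> P. {b \<in> {..<R}. h b = x}) = {..<R}" using assms(2) by auto
  then have "R \<le> (\<Sum>x \<in> P. card {b \<in> {..<R}. h b = x})"
    using card_UN_le[OF assms(1), of "\<lambda>x. {b \<in> {..<R}. h b = x}"] by (metis card_lessThan)
  also have "\<dots> \<le> (\<Sum>x \<in> P. k)"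
    by (rule sum_mono) (use neg in \<open>auto simp: not_le\<close>)
  finally show False using assms(3) by simp
qed

text \<open>Induction on the number of coordinates. Each value \<open>b\<close> of the last
  coordinate has a homogeneous box for the others inside \<open>{..<R}\<close>. There are finitely
  many pairs of box and colour, so \<open>k\<close> values of \<open>b\<close> share one.\<close>

lemma product_Ramsey:
  "\<exists>R. \<forall>c :: (nat \<Rightarrow> nat) \<Rightarrow> bool. \<exists>S v.
     (\<forall>i \<in> {1..n}. S i \<subseteq> {..<R} \<and> card (S i) = k) \<and> (\<forall>\<eta> \<in> Pi\<^sub>E {1..n} S. c \<eta> = v)"
proof (induction n)
  case 0
  then show ?case by auto
next
  case (Suc n)
  then obtain R where R: "\<And>c :: (nat \<Rightarrow> nat) \<Rightarrow> bool. \<exists>S v.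
     (\<forall>i \<in> {1..n}. S i \<subseteq> {..<R} \<and> card (S i) = k) \<and> (\<forall>\<eta> \<in> Pi\<^sub>E {1..n} S. c \<eta> = v)"
    by blast
  define P :: "((nat \<Rightarrow> nat set) \<times> bool) set" where "P = Pi\<^sub>E {1..n} (\<lambda>_. Pow {..<R}) \<times> UNIV"
  define R' where "R' = R + card P * k + 1"
  have "finite P" unfolding P_def by (intro finite_cartesian_product finite_PiE) auto
  have "\<exists>S v. (\<forall>i \<in> {1..Suc n}. S i \<subseteq> {..<R'} \<and> card (S i) = k) \<and> (\<forall>\<eta> \<in> Pi\<^sub>E {1..Suc n} S. c \<eta> = v)"
    for c :: "(nat \<Rightarrow> nat) \<Rightarrow> bool"
  proof -
    have "\<exists>p. (\<forall>i \<in> {1..n}. fst p i \<subseteq> {..<R} \<and> card (fst p i) = k) \<and>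
        (\<forall>\<eta> \<in> Pi\<^sub>E {1..n} (fst p). c (\<eta>(Suc n := b)) = snd p)" for b
      using R[of "\<lambda>\<eta>. c (\<eta>(Suc n := b))"] by (metis fst_conv snd_conv)
    then obtain p where p: "\<And>b. (\<forall>i \<in> {1..n}. fst (p b) i \<subseteq> {..<R} \<and> card (fst (p b) i) = k) \<and>
        (\<forall>\<eta> \<in> Pi\<^sub>E {1..n} (fst (p b)). c (\<eta>(Suc n := b)) = snd (p b))"
      using choice[of "\<lambda>b p. (\<forall>i \<in> {1..n}. fst p i \<subseteq> {..<R} \<and> card (fst p i) = k) \<and>
        (\<forall>\<eta> \<in> Pi\<^sub>E {1..n} (fst p). c (\<eta>(Suc n := b)) = snd p)"] by blast
    define S v where "S = (\<lambda>b. fst (p b))" and "v = (\<lambda>b. snd (p b))"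
    have Sv: "\<And>b i. i \<in> {1..n} \<Longrightarrow> S b i \<subseteq> {..<R} \<and> card (S b i) = k"
      "\<And>b \<eta>. \<eta> \<in> Pi\<^sub>E {1..n} (S b) \<Longrightarrow> c (\<eta>(Suc n := b)) = v b"
      using p by (auto simp: S_def v_def)
    \<comment> \<open>Restricting \<open>S b\<close> to \<open>{1..n}\<close> makes the values of
      \<open>h\<close> range over the finite set \<open>P\<close>.\<close>
    define h where "h = (\<lambda>b. (restrict (S b) {1..n}, v b))"
    have "h ` {..<R'} \<subseteq> P" using Sv(1) by (force simp: h_def P_def)
    then obtain x where x: "x \<in> P" "k \<le> card {b \<in> {..<R'}. h b = x}"
      using pigeonhole_fibre[OF \<open>finite P\<close>, of h R' k] by (auto simp: R'_def)
    obtain T where T: "T \<subseteq> {b \<in> {..<R'}. h b = x}" "card T = k"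
      by (rule obtain_subset_with_card_n[OF x(2)])
    show ?thesis
    \<comment> \<open>For \<open>k = 0\<close> the set \<open>T\<close> is empty and supplies no
      \<open>b0\<close>; empty sides do instead.\<close>
    proof (cases "k = 0")
      case True
      have "Pi\<^sub>E {1..Suc n} (\<lambda>_. {}) = ({} :: (nat \<Rightarrow> nat) set)" by (auto simp: PiE_eq_empty_iff)
      then show ?thesis using True by (intro exI[of _ "\<lambda>_. {}"]) simp
    next
      case False
      then obtain b0 where "b0 \<in> T" using T(2) by fastforce
      then have b0: "h b0 = x" using T(1) by blast
      have same: "restrict (S b) {1..n} = restrict (S b0) {1..n}" "v b = v b0" if "b \<in> T" for b
        using that T(1) b0 by (auto simp: h_def)
      define S' where "S' = (S b0)(Suc n := T)"
      have "c \<eta> = v b0" if "\<eta> \<in> Pi\<^sub>E {1..Suc n} S'" for \<eta>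
      proof -
        have mem: "\<eta> i \<in> S' i" if "i \<in> {1..Suc n}" for i
          using \<open>\<eta> \<in> Pi\<^sub>E {1..Suc n} S'\<close> that by (rule PiE_mem)
        have T': "\<eta> (Suc n) \<in> T" using mem[of "Suc n"] by (simp add: S'_def)
        have "\<eta> i \<in> S (\<eta> (Suc n)) i" if "i \<in> {1..n}" for i
          using mem[of i] that fun_cong[OF same(1)[OF T'], of i] by (auto simp: S'_def)
        then have "restrict \<eta> {1..n} \<in> Pi\<^sub>E {1..n} (S (\<eta> (Suc n)))" by simp
        then have "c ((restrict \<eta> {1..n})(Suc n := \<eta> (Suc n))) = v b0"
          using Sv(2) same(2)[OF T'] by metis
        also have "(restrict \<eta> {1..n})(Suc n := \<eta> (Suc n)) = \<eta>"
          using PiE_arb[OF that] by (auto simp: fun_eq_iff)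
        finally show ?thesis .
      qed
      moreover have "S' i \<subseteq> {..<R'} \<and> card (S' i) = k" if "i \<in> {1..Suc n}" for i
      proof (cases "i = Suc n")
        case True
        then show ?thesis using T by (auto simp: S'_def)
      next
        case False
        then show ?thesis using that Sv(1)[of i b0] by (force simp: S'_def R'_def)
      qed
      ultimately show ?thesis by (intro exI[of _ S'] exI[of _ "v b0"]) simp
    qed
  qed
  then show ?case by blast
qed

text \<open>Colour a large grid by membership in \<open>W\<close> and pass to a homogeneous subgrid.
  The bound is uniform in the sets, so it can serve all fibres at once.\<close>

lemma has_grid_Un:
  "\<exists>R. \<forall>(X :: nat \<Rightarrow> 'b set) W W'. has_grid n X (W \<union> W') R \<longrightarrow> has_grid n X W k \<or> has_grid n X W' k"
proof -
  obtain R where R: "\<And>c :: (nat \<Rightarrow> nat) \<Rightarrow> bool. \<exists>S v.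
     (\<forall>i \<in> {1..n}. S i \<subseteq> {..<R} \<and> card (S i) = k) \<and> (\<forall>\<eta> \<in> Pi\<^sub>E {1..n} S. c \<eta> = v)"
    using product_Ramsey[of n k] by blast
  have "has_grid n X W k \<or> has_grid n X W' k" if grid: "has_grid n X (W \<union> W') R"
    for X :: "nat \<Rightarrow> 'b set" and W W'
  proof -
    obtain a where a: "is_grid n X (W \<union> W') R a" using grid unfolding has_grid_def by (elim exE)
    obtain S v where Sv: "\<forall>i \<in> {1..n}. S i \<subseteq> {..<R} \<and> card (S i) = k"
      "\<forall>\<eta> \<in> Pi\<^sub>E {1..n} S. ((\<lambda>i \<in> {1..n}. a i (\<eta> i)) \<in> W) = v"
      using R[of "\<lambda>\<eta>. (\<lambda>i \<in> {1..n}. a i (\<eta> i)) \<in> W"] by (elim exE conjE)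
    then have S: "\<And>i. i \<in> {1..n} \<Longrightarrow> S i \<subseteq> {..<R}" "\<And>i. i \<in> {1..n} \<Longrightarrow> card (S i) = k"
      and v: "\<And>\<eta>. \<eta> \<in> Pi\<^sub>E {1..n} S \<Longrightarrow> ((\<lambda>i \<in> {1..n}. a i (\<eta> i)) \<in> W) = v"
      by simp_all
    have "\<forall>i. \<exists>g. i \<in> {1..n} \<longrightarrow> bij_betw g {..<k} (S i)"
      using S ex_bij_betw_nat_finite by (metis finite_lessThan finite_subset atLeast0LessThan)
    then obtain g where g: "\<And>i. i \<in> {1..n} \<Longrightarrow> bij_betw (g i) {..<k} (S i)" by metis
    have gS: "g i j \<in> S i" "g i j < R" if "i \<in> {1..n}" "j < k" for i j
      using bij_betwE[OF g[OF that(1)]] S(1)[OF that(1)] that(2) by auto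
    have "is_grid n X (if v then W else W') k (\<lambda>i j. a i (g i j))"
      unfolding is_grid_def
    proof (intro conjI ballI)
      fix i assume i: "i \<in> {1..n}"
      show "a i (g i j) \<in> X i" if "j \<in> {..<k}" for j
        using a i gS(2)[OF i] that by (auto simp: is_grid_def)
      have "inj_on (a i) (g i ` {..<k})"
        by (rule inj_on_subset[of _ "{..<R}"]) (use a i gS(2)[OF i] in \<open>auto simp: is_grid_def\<close>)
      then show "inj_on (\<lambda>j. a i (g i j)) {..<k}"
        using comp_inj_on[of "g i" "{..<k}" "a i"] g[OF i] by (simp add: bij_betw_def comp_def)
    next
      fix \<eta> assume \<eta>: "\<eta> \<in> Pi\<^sub>E {1..n} (\<lambda>_. {..<k})"
      define \<theta> where "\<theta> = (\<lambda>i \<in> {1..n}. g i (\<eta> i))"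
      have "\<eta> i < k" if "i \<in> {1..n}" for i using PiE_mem[OF \<eta> that] by simp
      then have \<theta>: "\<theta> \<in> Pi\<^sub>E {1..n} S" "\<theta> \<in> Pi\<^sub>E {1..n} (\<lambda>_. {..<R})"
        using gS by (auto simp: \<theta>_def)
      have eq: "(\<lambda>i \<in> {1..n}. a i (g i (\<eta> i))) = (\<lambda>i \<in> {1..n}. a i (\<theta> i))"
        by (rule restrict_ext) (simp add: \<theta>_def)
      have "(\<lambda>i \<in> {1..n}. a i (\<theta> i)) \<in> W \<union> W'" using a \<theta>(2) unfolding is_grid_def by blast
      then show "(\<lambda>i \<in> {1..n}. a i (g i (\<eta> i))) \<in> (if v then W else W')"
        unfolding eq using v[OF \<theta>(1)] by auto
    qed
    then show ?thesis unfolding has_grid_def by (cases v) auto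
  qed
  then show ?thesis by blast
qed

text \<open>Each \<open>N\<close>-element set of indices is coloured by some \<open>s\<close> that
  works for its increasing enumeration; \<open>h\<close> enumerates an infinite homogeneous
  set.\<close>

lemma increasing_Ramsey:
  fixes R :: "'c \<Rightarrow> (nat \<Rightarrow> nat) \<Rightarrow> bool"
  assumes "finite P" and ex: "\<And>f. strict_mono_on {..<N} f \<Longrightarrow> \<exists>s \<in> P. R s f"
    and cong: "\<And>s f g. (\<And>j. j < N \<Longrightarrow> f j = g j) \<Longrightarrow> R s f = R s g"
  shows "\<exists>h s. strict_mono h \<and> s \<in> P \<and> (\<forall>f :: nat \<Rightarrow> nat. strict_mono_on {..<N} f \<longrightarrow> R s (\<lambda>j. h (f j)))"
proof -
  define en where "en = (\<lambda>F :: nat set. \<lambda>j. sorted_list_of_set F ! j)"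
  have mono: "strict_mono_on {..<N} (en F)" if "finite F" "card F = N" for F
    using that unfolding en_def
    by (intro strict_mono_onI) (auto simp: sorted_wrt_nth_less[OF strict_sorted_list_of_set])
  obtain enc :: "'c \<Rightarrow> nat" and p where enc: "bij_betw enc P {0..<p}"
    using ex_bij_betw_finite_nat[OF \<open>finite P\<close>] by blast
  define col where "col = (\<lambda>F. enc (SOME s. s \<in> P \<and> R s (en F)))"
  have some: "(SOME s. s \<in> P \<and> R s (en F)) \<in> P \<and> R (SOME s. s \<in> P \<and> R s (en F)) (en F)"
    if "finite F" "card F = N" for F
    using someI_ex[of "\<lambda>s. s \<in> P \<and> R s (en F)"] ex[OF mono[OF that]] by blast
  have "\<forall>F. F \<subseteq> UNIV \<and> finite F \<and> card F = N \<longrightarrow> col F < p"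
    using some bij_betwE[OF enc] unfolding col_def by auto
  from Ramsey[OF infinite_UNIV_nat this] obtain H t where H: "infinite H" "t < p"
    "\<And>F. F \<subseteq> H \<Longrightarrow> finite F \<Longrightarrow> card F = N \<Longrightarrow> col F = t"
    by blast
  obtain s where s: "s \<in> P" "enc s = t"
    using enc H(2) by (auto simp: bij_betw_def image_iff)
      (metis atLeastLessThan_iff image_iff le0)
  have h: "strict_mono (enumerate H)" using strict_mono_enumerate[OF H(1)] .
  have "R s (\<lambda>j. enumerate H (f j))" if f: "strict_mono_on {..<N} f" for f
  proof -
    let ?g = "\<lambda>j. enumerate H (f j)"
    have g: "strict_mono_on {..<N} ?g"
      using f h unfolding strict_mono_on_def strict_mono_def by blast
    define F where "F = ?g ` {..<N}"
    have inj: "inj_on ?g {..<N}" using g by (rule strict_mono_on_imp_inj_on)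
    have F: "finite F" "card F = N" "F \<subseteq> H"
      using enumerate_in_set[OF H(1)] by (auto simp: F_def card_image[OF inj])
    have "sorted_list_of_set F = map ?g [0..<N]"
    proof (rule strict_sorted_equal)
      show "sorted_wrt (<) (map ?g [0..<N])"
        using g by (auto simp: sorted_wrt_iff_nth_less strict_mono_on_def)
      show "sorted_wrt (<) (sorted_list_of_set F)" by simp
      show "set (sorted_list_of_set F) = set (map ?g [0..<N])"
        using F(1) by (auto simp: F_def)
    qed
    then have "en F j = ?g j" if "j < N" for j using that by (simp add: en_def)
    then have "R s' (en F) = R s' ?g" for s' by (rule cong)
    moreover have "enc (SOME s. s \<in> P \<and> R s (en F)) = t" using H(3) F unfolding col_def by blast
    then have "(SOME s. s \<in> P \<and> R s (en F)) = s"
      using enc s some[OF F(1,2)] by (auto simp: bij_betw_def inj_on_def)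
    ultimately show ?thesis using some[OF F(1,2)] by metis
  qed
  then show ?thesis using h s(1) by blast
qed

section \<open>Grids in definable families\<close>

context saturated_structure
begin

text \<open>Membership in \<open>W b\<close> is definable jointly in the point (variables \<open>Inr\<close>) and the parameter \<open>b\<close>
  (variables \<open>Inl\<close>).\<close>

definition definable_family :: "('w \<Rightarrow> nat) \<Rightarrow> (nat \<Rightarrow> nat) \<Rightarrow> nat \<Rightarrow> (('w \<Rightarrow> 'a list) \<Rightarrow> (nat \<Rightarrow> 'a list) set) \<Rightarrow> bool"
  where
  "definable_family s m n W \<longleftrightarrow> tuple_definable (case_sum s m) (\<lambda>E. (\<lambda>i \<in> {1..n}. E (Inr i)) \<in> W (\<lambda>w. E (Inl w)))"

lemma definable_family_const: 
  assumes "tuple_definable m (\<lambda>E. (\<lambda>i \<in> {1..n}. E i) \<in> W)"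
  shows "definable_family s m n (\<lambda>_. W)"
  unfolding definable_family_def using tuple_definable_rename[OF assms, where h = Inr and s = "case_sum s m"] by simp

lemma definable_family_instance:
  assumes "definable_family s m n W" "\<And>w. length (b w) = s w"
  shows "tuple_definable m (\<lambda>E. (\<lambda>i \<in> {1..n}. E i) \<in> W b)"
  using tuple_definable_reindex[OF assms(1)[unfolded definable_family_def], where h = "case_sum (\<lambda>w. Inr (b w)) Inl" and s = m] assms(2)
  by (simp split: sum.splits)

text \<open>The maps \<open>h\<close> and \<open>g\<close> locate the parameter and the grid entries
  among the variables. This covers both quantifying the entries away and realising them by
  saturation.\<close>

lemma tuple_definable_is_grid:
  assumes X: "\<And>i. i \<in> {1..n} \<Longrightarrow> definable L M (m i) (X i)" and W: "definable_family s m n W"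
    and s': "\<And>w. s' (h w) = s w" "\<And>i j. s' (g i j) = m i"
  shows "tuple_definable s' (\<lambda>E. is_grid n X (W (\<lambda>w. E (h w))) k (\<lambda>i j. E (g i j)))"
proof -
  have 1: "tuple_definable s' (\<lambda>E. E (g i j) \<in> X i)" if "i \<in> {1..n}" for i j
    using tuple_definable_definable[of s' "g i j" "X i"] X[OF that] s'(2) by simp
  have 2: "tuple_definable s' (\<lambda>E. (\<lambda>i \<in> {1..n}. E (g i (\<eta> i))) \<in> W (\<lambda>w. E (h w)))" for \<eta>
    using tuple_definable_rename[OF W[unfolded definable_family_def], where h = "case_sum h (\<lambda>i. g i (\<eta> i))" and s = s'] s'
    by (simp split: sum.splits)
  have 3: "tuple_definable s' (\<lambda>E. \<forall>j \<in> {..<k}. \<forall>j' \<in> {..<k}. E (g i j) = E (g i j') \<longrightarrow> j = j')" for i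
    by (intro tuple_definable_ball tuple_definable_imp tuple_definable_eq tuple_definable_const finite_lessThan) (simp add: s')
  show ?thesis unfolding is_grid_def inj_on_def
    by (intro tuple_definable_conj tuple_definable_ball 1 2 3 finite_lessThan finite_atLeastAtMost finite_PiE)
qed

lemma tuple_definable_has_grid:
  assumes X: "\<And>i. i \<in> {1..n} \<Longrightarrow> definable L M (m i) (X i)" and W: "definable_family s m n W"
  shows "tuple_definable s (\<lambda>E. has_grid n X (W E) k)"
proof -
  have len: "length x = m i" if "x \<in> X i" "i \<in> {1..n}" for x i
    using X[OF that(2)] that(1) by (auto simp: definable_def)
  have "has_grid n X (W E) k \<longleftrightarrow>
      (\<exists>F. (\<forall>u. length (F u) = m (fst u)) \<and> is_grid n X (W E) k (\<lambda>i j. F (i, j)))" for E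
  proof
    assume "has_grid n X (W E) k"
    then obtain a where a: "is_grid n X (W E) k a" unfolding has_grid_def by (elim exE)
    \<comment> \<open>Positions outside the grid are filled with lists of the right length, since
      the quantifier ranges over such lists only.\<close>
    define F where "F = (\<lambda>(i, j). if i \<in> {1..n} \<and> j < k then a i j else replicate (m i) undefined)"
    have "is_grid n X (W E) k (\<lambda>i j. F (i, j))"
      by (rule is_grid_cong[OF a]) (simp add: F_def)
    moreover have "\<forall>u. length (F u) = m (fst u)"
      using a len by (auto simp: F_def is_grid_def)
    ultimately show "\<exists>F. (\<forall>u. length (F u) = m (fst u)) \<and> is_grid n X (W E) k (\<lambda>i j. F (i, j))"
      by blast
  qed (auto simp: has_grid_def)
  moreover have "tuple_definable s (\<lambda>E. \<exists>F. (\<forall>u. length (F u) = m (fst u)) \<and> is_grid n X (W E) k (\<lambda>i j. F (i, j)))"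
    by (rule tuple_definable_exs, rule tuple_definable_is_grid[OF X W, where h = Inl and g = "\<lambda>i j. Inr (i, j)"]) auto
  ultimately show ?thesis by simp
qed

text \<open>The entries of an infinite array are the variables. A grid of size \<open>N\<close>
  satisfies the first \<open>N\<close> corner conditions, so saturation realises all corners in a
  single array.\<close>

lemma broad_iff_has_grid:
  assumes X: "\<And>i. i \<in> {1..n} \<Longrightarrow> definable L M (m i) (X i)"
    and W: "tuple_definable m (\<lambda>E. (\<lambda>i \<in> {1..n}. E i) \<in> W)"
  shows "broad n X W \<longleftrightarrow> (\<forall>k. has_grid n X W k)"
proof
  assume grid: "\<forall>k. has_grid n X W k"
  define s where "s = (\<lambda>u :: nat \<times> nat. m (fst u))"
  have len: "length x = m i" if "x \<in> X i" "i \<in> {1..n}" for x i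
    using X[OF that(2)] that(1) by (auto simp: definable_def)
  have "\<exists>E. (\<forall>u. length (E u) = s u) \<and> (\<forall>k. is_grid n X W k (\<lambda>i j. E (i, j)))"
  proof (rule tuple_saturation)
    show "tuple_definable s (\<lambda>E. is_grid n X W k (\<lambda>i j. E (i, j)))" for k
      using tuple_definable_is_grid[OF X definable_family_const[OF W, of s], where h = "\<lambda>u. u" and g = Pair and s' = s]
      by (simp add: s_def)
    fix N
    have "has_grid n X W N" using grid by (rule spec)
    then obtain a where a: "is_grid n X W N a" unfolding has_grid_def by (elim exE)
    define F where "F = (\<lambda>(i, j). if i \<in> {1..n} \<and> j < N then a i j else replicate (m i) undefined)"
    have "is_grid n X W N (\<lambda>i j. F (i, j))"
      by (rule is_grid_cong[OF a]) (simp add: F_def)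
    then have "\<forall>t<N. is_grid n X W t (\<lambda>i j. F (i, j))"
      by (meson is_grid_mono less_imp_le order_refl)
    moreover have "\<forall>u. length (F u) = s u"
      using a len by (auto simp: F_def s_def is_grid_def)
    ultimately show "\<exists>E. (\<forall>u. length (E u) = s u) \<and> (\<forall>t<N. is_grid n X W t (\<lambda>i j. E (i, j)))"
      by blast
  qed
  then show "broad n X W" using is_grid_imp_broad by blast
qed (simp add: broad_imp_has_grid)

end

section \<open>Patterns of fibres under NIP\<close>

lemma restrict_upd:
  "(\<lambda>i \<in> {1..n}. F i)(Suc n := y) = (\<lambda>i \<in> {1..Suc n}. if i = Suc n then y else F i)"
  by (auto simp: fun_eq_iff)

locale nip_structure = saturated_structure L \<kappa> M
  for L :: "('f, 'r) language" and \<kappa> :: "'k rel" and M :: "('f, 'r, 'a) struct" +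
  assumes no_IP: "p \<in> fms L (k + l) \<Longrightarrow> \<not> has_IP M p k l"

text \<open>The last coordinate is split off: \<open>Y\<close> is viewed as a family of fibres in
  the first \<open>n\<close> coordinates, indexed by \<open>X (Suc n)\<close>.\<close>

locale definable_relation = nip_structure L \<kappa> M
  for L :: "('f, 'r) language" and \<kappa> :: "'k rel" and M :: "('f, 'r, 'a) struct" +
  fixes n :: nat and m :: "nat \<Rightarrow> nat" and X :: "nat \<Rightarrow> 'a list set" and Y :: "(nat \<Rightarrow> 'a list) set"
  assumes X: "i \<in> {1..Suc n} \<Longrightarrow> definable L M (m i) (X i)"
    and Y: "tuple_definable m (\<lambda>E. (\<lambda>i \<in> {1..Suc n}. E i) \<in> Y)"
begin

lemma length_X: "x \<in> X i \<Longrightarrow> i \<in> {1..Suc n} \<Longrightarrow> length x = m i"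
  using X by (auto simp: definable_def)

lemma X': "i \<in> {1..n} \<Longrightarrow> definable L M (m i) (X i)"
  using X by simp

lemma tuple_definable_Y:
  assumes "\<And>i. s (g i) = m i" "s v = m (Suc n)"
  shows "tuple_definable s (\<lambda>E. (\<lambda>i \<in> {1..n}. E (g i))(Suc n := E v) \<in> Y)"
proof -
  have "tuple_definable s (\<lambda>E. (\<lambda>i \<in> {1..Suc n}. E (if i = Suc n then v else g i)) \<in> Y)"
    by (rule tuple_definable_rename[OF Y]) (use assms in auto)
  then show ?thesis by (simp only: restrict_upd if_distrib)
qed

text \<open>A cell of the Venn diagram of the first \<open>k\<close> fibres; these are shattered iff
  no cell is empty.\<close>

definition pattern :: "nat \<Rightarrow> (nat \<Rightarrow> bool) \<Rightarrow> (nat \<Rightarrow> 'a list) \<Rightarrow> (nat \<Rightarrow> 'a list) set" where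
  "pattern k s b = {\<alpha> \<in> Pi\<^sub>E {1..n} X. \<forall>j \<in> {..<k}. (\<alpha>(Suc n := b j) \<in> Y) = s j}"

lemma tuple_definable_PiE:
  assumes "\<And>i. i \<in> {1..n} \<Longrightarrow> definable L M (m i) (Z i)" "\<And>i. s (g i) = m i"
  shows "tuple_definable s (\<lambda>E. (\<lambda>i \<in> {1..n}. E (g i)) \<in> Pi\<^sub>E {1..n} Z)"
proof -
  have "tuple_definable s (\<lambda>E. \<forall>i \<in> {1..n}. E (g i) \<in> Z i)"
    by (intro tuple_definable_ball tuple_definable_definable finite_atLeastAtMost) (simp add: assms)
  then show ?thesis by (simp add: Ball_def Pi_iff)
qed

lemma definable_family_pat: "definable_family (\<lambda>_. m (Suc n)) m n (pattern k s)"
  unfolding definable_family_def pattern_def mem_Collect_eq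
  by (intro tuple_definable_conj tuple_definable_ball tuple_definable_iff_const tuple_definable_PiE tuple_definable_Y X' finite_lessThan) simp_all

lemma definable_family_diff:
  assumes "definable_family s m n W" "s' v = m (Suc n)" "\<And>w. s' (g w) = s w"
  shows "definable_family s' m n (\<lambda>E. {\<alpha> \<in> W (\<lambda>w. E (g w)). \<alpha>(Suc n := E v) \<notin> Y})"
proof -
  have "tuple_definable (case_sum s' m) (\<lambda>E. (\<lambda>i \<in> {1..n}. E (Inr i)) \<in> W (\<lambda>w. E (Inl (g w))))"
    using tuple_definable_rename[OF assms(1)[unfolded definable_family_def], where h = "case_sum (\<lambda>w. Inl (g w)) Inr" and s = "case_sum s' m"]
      assms(3) by (simp split: sum.splits)
  then show ?thesis
    unfolding definable_family_def mem_Collect_eq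
    by (intro tuple_definable_conj tuple_definable_neg tuple_definable_Y) (use assms(2) in simp_all)
qed

lemma pattern_cong:
  assumes "\<And>j. j < k \<Longrightarrow> b j = b' j" "\<And>j. j < k \<Longrightarrow> s j = s' j"
  shows "pattern k s b = pattern k s' b'"
  unfolding pattern_def using assms by auto

text \<open>If \<open>2\<^sup>d\<close> fibres, indexed by the subsets of \<open>{..<d}\<close>, are shattered, then the dual family
  shatters \<open>d\<close> points; saturation, first over the points and then over \<open>b\<close> for each infinite set of
  points, yields the independence property.\<close>

lemma shatter_bound:
  "\<exists>N. \<forall>b. (\<forall>j<N. b j \<in> X (Suc n)) \<longrightarrow> (\<exists>s. pattern N s b = {})"
proof (rule ccontr)
  assume neg: "\<not> ?thesis"
  define \<sigma> where "\<sigma> = (\<lambda>u :: nat \<times> nat. m (snd u))"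
  \<comment> \<open>The parameters cutting out the subsets of the first \<open>d\<close> points stay
    quantified, so that only the points are realised here.\<close>
  define Q where "Q = (\<lambda>d (E :: nat \<times> nat \<Rightarrow> 'a list). \<forall>S \<in> Pow {..<d}. \<exists>F :: unit \<Rightarrow> 'a list.
      (\<forall>u. length (F u) = m (Suc n)) \<and>
      (\<forall>i \<in> {..<d}. ((\<lambda>w \<in> {1..n}. E (i, w))(Suc n := F ()) \<in> Y) = (i \<in> S)))"
  have "\<exists>E. (\<forall>u. length (E u) = \<sigma> u) \<and> (\<forall>d. Q d E)"
  proof (rule tuple_saturation)
    show "tuple_definable \<sigma> (Q d)" for d
      unfolding Q_def
      by (intro tuple_definable_ball tuple_definable_exs tuple_definable_iff_const tuple_definable_Y) (auto simp: \<sigma>_def)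
  next
    fix d :: nat
    obtain h where h: "bij_betw h {0..<card (Pow {..<d})} (Pow {..<d})"
      using ex_bij_betw_nat_finite[of "Pow {..<d}"] by (elim meta_impE exE) simp_all
    define N where "N = card (Pow {..<d})"
    obtain b where b: "\<forall>j<N. b j \<in> X (Suc n)" "\<And>s. pattern N s b \<noteq> {}" using neg by meson
    \<comment> \<open>Duality: the point \<open>\<alpha> i\<close> lies in the fibre of
      \<open>b j\<close> iff \<open>i \<in> h j\<close>, and \<open>h\<close> enumerates the subsets
      of \<open>{..<d}\<close>.\<close>
    have "\<forall>i. \<exists>\<alpha>. \<alpha> \<in> pattern N (\<lambda>j. i \<in> h j) b" using b(2) by blast
    then obtain \<alpha> where \<alpha>: "\<And>i. \<alpha> i \<in> pattern N (\<lambda>j. i \<in> h j) b" by metis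
    define E where "E = (\<lambda>(i, w). if w \<in> {1..n} then \<alpha> i w else replicate (m w) undefined)"
    have \<alpha>X: "\<alpha> i \<in> Pi\<^sub>E {1..n} X" for i using \<alpha>[of i] by (simp add: pattern_def)
    have "\<alpha> i w \<in> X w" if "w \<in> {1..n}" for i w using PiE_mem[OF \<alpha>X that] .
    then have "length (E u) = \<sigma> u" for u
      using length_X by (auto simp: E_def \<sigma>_def split: prod.splits)
    moreover have "Q t E" if "t < d" for t
      unfolding Q_def
    proof
      fix S assume "S \<in> Pow {..<t}"
      then have "S \<in> h ` {0..<N}" using that bij_betw_imp_surj_on[OF h] by (auto simp: N_def)
      then obtain j where j: "j < N" "h j = S" by auto
      have "(\<lambda>w \<in> {1..n}. E (i, w)) = \<alpha> i" for i
        by (rule extensionalityI[of _ "{1..n}"]) (use \<alpha>X[of i] in \<open>auto simp: E_def PiE_def\<close>)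
      moreover have "((\<alpha> i)(Suc n := b j) \<in> Y) = (i \<in> S)" for i
        using \<alpha>[of i] j by (auto simp: pattern_def)
      moreover have "length (b j) = m (Suc n)" using b(1) j(1) length_X by auto
      ultimately show "\<exists>F :: unit \<Rightarrow> 'a list. (\<forall>u. length (F u) = m (Suc n)) \<and>
          (\<forall>i \<in> {..<t}. ((\<lambda>w \<in> {1..n}. E (i, w))(Suc n := F ()) \<in> Y) = (i \<in> S))"
        by (intro exI[of _ "\<lambda>_. b j"]) simp
    qed
    ultimately show "\<exists>E. (\<forall>u. length (E u) = \<sigma> u) \<and> (\<forall>t<d. Q t E)" by blast
  qed
  then obtain E where E: "\<And>u. length (E u) = \<sigma> u" "\<And>d. Q d E" by blast
  \<comment> \<open>Now the points are fixed, and a set \<open>S\<close> imposes infinitely many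
    conditions on one parameter; finitely many at a time are met by some \<open>Q d\<close>.\<close>
  have "\<exists>y. length y = m (Suc n) \<and> (\<forall>i. ((\<lambda>w \<in> {1..n}. E (i, w))(Suc n := y) \<in> Y) = (i \<in> S))" for S
  proof -
    have "\<exists>F :: unit \<Rightarrow> 'a list. (\<forall>u. length (F u) = m (Suc n)) \<and>
        (\<forall>i. ((\<lambda>w \<in> {1..n}. E (i, w))(Suc n := F ()) \<in> Y) = (i \<in> S))"
    proof (rule tuple_saturation)
      fix i
      have "tuple_definable (\<lambda>_ :: unit. m (Suc n)) (\<lambda>F. (\<lambda>w \<in> {1..Suc n}.
          case_sum F id (if w = Suc n then Inl () else Inr (E (i, w)))) \<in> Y)"
        by (rule tuple_definable_reindex[OF Y]) (simp add: E(1) \<sigma>_def)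
      moreover have "(\<lambda>w \<in> {1..Suc n}. case_sum F id (if w = Suc n then Inl () else Inr (E (i, w)))) =
          (\<lambda>w \<in> {1..n}. E (i, w))(Suc n := F ())" for F :: "unit \<Rightarrow> 'a list"
        unfolding restrict_upd by (rule restrict_ext) simp
      ultimately show "tuple_definable (\<lambda>_ :: unit. m (Suc n)) (\<lambda>F. ((\<lambda>w \<in> {1..n}. E (i, w))(Suc n := F ()) \<in> Y) = (i \<in> S))"
        by (intro tuple_definable_iff_const) simp
    next
      fix d
      have "S \<inter> {..<d} \<in> Pow {..<d}" by simp
      then have "\<exists>F :: unit \<Rightarrow> 'a list. (\<forall>u. length (F u) = m (Suc n)) \<and>
        (\<forall>i \<in> {..<d}. ((\<lambda>w \<in> {1..n}. E (i, w))(Suc n := F ()) \<in> Y) = (i \<in> S \<inter> {..<d}))"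
        by (rule bspec[OF E(2)[of d, unfolded Q_def]])
      then show "\<exists>F :: unit \<Rightarrow> 'a list. (\<forall>u. length (F u) = m (Suc n)) \<and>
        (\<forall>i<d. ((\<lambda>w \<in> {1..n}. E (i, w))(Suc n := F ()) \<in> Y) = (i \<in> S))"
        by auto
    qed
    then show ?thesis by blast
  qed
  then obtain y where y: "\<And>S. length (y S) = m (Suc n)"
    "\<And>S i. ((\<lambda>w \<in> {1..n}. E (i, w))(Suc n := y S) \<in> Y) = (i \<in> S)" by metis
  let ?vs = "block m [1..<Suc (Suc n)]"
  have "\<exists>c. \<exists>p \<in> fms L (length ?vs + length c). \<forall>e. holds M p (map e ?vs @ c) \<longleftrightarrow>
      (\<lambda>i \<in> {1..Suc n}. tup m e i) \<in> Y"
  proof (rule holds_if_env_definable[OF Y[unfolded tuple_definable_def]])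
    fix e e' :: "nat \<times> nat \<Rightarrow> 'a"
    assume eq: "\<And>v. v \<in> set ?vs \<Longrightarrow> e v = e' v"
    have "(\<lambda>i \<in> {1..Suc n}. tup m e i) = (\<lambda>i \<in> {1..Suc n}. tup m e' i)"
    proof (rule restrict_ext)
      fix i assume "i \<in> {1..Suc n}"
      then show "tup m e i = tup m e' i"
        unfolding tup_def by (intro map_cong refl eq) (auto simp: set_block simp del: upt_Suc)
    qed
    then show "((\<lambda>i \<in> {1..Suc n}. tup m e i) \<in> Y) = ((\<lambda>i \<in> {1..Suc n}. tup m e' i) \<in> Y)" by simp
  qed
  then obtain c p where p: "p \<in> fms L (length ?vs + length c)"
    "\<And>e. holds M p (map e ?vs @ c) \<longleftrightarrow> (\<lambda>i \<in> {1..Suc n}. tup m e i) \<in> Y"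
    by blast
  let ?us = "block m [1..<Suc n]"
  have vs: "?vs = ?us @ map (Pair (Suc n)) [0..<m (Suc n)]"
    by (simp add: block_def)
  define a where "a = (\<lambda>i. map (\<lambda>(w, t). E (i, w) ! t) ?us)"
  have "holds M p (a i @ y S @ c) \<longleftrightarrow> i \<in> S" for i S
  proof -
    define e where "e = (\<lambda>(w, t). if w = Suc n then y S ! t else E (i, w) ! t)"
    have "map e ?us = a i"
      unfolding a_def by (rule map_cong) (auto simp: set_block e_def simp del: upt_Suc)
    moreover have "map e (map (Pair (Suc n)) [0..<m (Suc n)]) = y S"
      using map_nth[of "y S"] y(1)[of S] by (simp add: comp_def e_def)
    ultimately have "map e ?vs @ c = a i @ y S @ c" unfolding vs by simp
    moreover have "(\<lambda>w \<in> {1..Suc n}. tup m e w) = (\<lambda>w \<in> {1..n}. E (i, w))(Suc n := y S)"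
      unfolding restrict_upd
    proof (rule restrict_ext)
      fix w
      show "tup m e w = (if w = Suc n then y S else E (i, w))"
        using map_nth[of "y S"] map_nth[of "E (i, w)"] y(1)[of S] E(1)[of "(i, w)"]
        by (simp add: tup_def e_def \<sigma>_def)
    qed
    ultimately show ?thesis using p(2)[of e] y(2) by simp
  qed
  \<comment> \<open>The parameters \<open>c\<close> are appended to \<open>y S\<close>, since the
    independence property concerns formulas without parameters.\<close>
  then have "has_IP M p (length ?us) (m (Suc n) + length c)"
    unfolding has_IP_def
    by (intro exI[of _ a] exI[of _ "\<lambda>S. y S @ c"]) (simp add: a_def y(1))
  moreover have "p \<in> fms L (length ?us + (m (Suc n) + length c))"
    using p(1) vs by (simp add: add.assoc)
  ultimately show False using no_IP by blast
qed

text \<open>By \<open>fin\<close> each broad definable set has finitely many exceptional parameters;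
  compactness bounds their number as \<open>b\<close> varies. Otherwise saturation would give one
  broad pattern with infinitely many exceptions.\<close>

lemma uniform_gap_bound:
  assumes fin: "\<And>W l. \<lbrakk>tuple_definable m (\<lambda>E. (\<lambda>i \<in> {1..n}. E i) \<in> W); broad n X W\<rbrakk> \<Longrightarrow>
      finite {b \<in> X (Suc n). \<not> has_grid n X {\<alpha> \<in> W. \<alpha>(Suc n := b) \<notin> Y} l}"
  shows "\<exists>p :: nat. \<forall>b d. (\<forall>j. length (b j) = m (Suc n)) \<and> broad n X (pattern k s b) \<and>
      (\<forall>i<p. d i \<in> X (Suc n)) \<and> inj_on d {..<p} \<longrightarrow>
      (\<exists>i<p. has_grid n X {\<alpha> \<in> pattern k s b. \<alpha>(Suc n := d i) \<notin> Y} l)"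
proof (rule ccontr)
  assume neg: "\<not> ?thesis"
  define \<sigma> where "\<sigma> = (\<lambda>_ :: nat + nat. m (Suc n))"
  \<comment> \<open>Broadness is replaced by a grid of size \<open>p\<close>; over all
    \<open>p\<close> these conditions recover it.\<close>
  define Q where "Q = (\<lambda>p (E :: nat + nat \<Rightarrow> 'a list).
      has_grid n X (pattern k s (\<lambda>j. E (Inl j))) p \<and> (\<forall>i \<in> {..<p}. E (Inr i) \<in> X (Suc n)) \<and>
      (\<forall>i \<in> {..<p}. \<forall>j \<in> {..<p}. E (Inr i) = E (Inr j) \<longrightarrow> i = j) \<and>
      (\<forall>i \<in> {..<p}. \<not> has_grid n X {\<alpha> \<in> pattern k s (\<lambda>j. E (Inl j)). \<alpha>(Suc n := E (Inr i)) \<notin> Y} l))"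
  have "\<exists>E. (\<forall>u. length (E u) = \<sigma> u) \<and> (\<forall>p. Q p E)"
  proof (rule tuple_saturation)
    have 1: "definable_family \<sigma> m n (\<lambda>E. pattern k s (\<lambda>j. E (Inl j)))"
      unfolding definable_family_def
      using tuple_definable_rename[OF definable_family_pat[unfolded definable_family_def], where h = "case_sum (\<lambda>w. Inl (Inl w)) Inr" and s = "case_sum \<sigma> m"]
      by (simp add: \<sigma>_def split: sum.splits)
    have 2: "definable_family \<sigma> m n (\<lambda>E. {\<alpha> \<in> pattern k s (\<lambda>j. E (Inl j)). \<alpha>(Suc n := E (Inr i)) \<notin> Y})" for i
      by (rule definable_family_diff[OF definable_family_pat]) (simp_all add: \<sigma>_def)
    show "tuple_definable \<sigma> (Q p)" for p
      unfolding Q_def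
      by (intro tuple_definable_conj tuple_definable_ball tuple_definable_imp tuple_definable_neg tuple_definable_const tuple_definable_has_grid[OF X' 1] tuple_definable_has_grid[OF X' 2]
          tuple_definable_definable tuple_definable_eq) (simp_all add: \<sigma>_def X)
  next
    fix p :: nat
    have "\<exists>b d. ((\<forall>j. length (b j) = m (Suc n)) \<and> broad n X (pattern k s b) \<and>
        (\<forall>i<p. d i \<in> X (Suc n)) \<and> inj_on d {..<p}) \<and>
        \<not> (\<exists>i<p. has_grid n X {\<alpha> \<in> pattern k s b. \<alpha>(Suc n := d i) \<notin> Y} l)"
      using neg unfolding not_ex not_all not_imp by (rule spec)
    then obtain b d where bd: "\<forall>j. length (b j) = m (Suc n)" "broad n X (pattern k s b)"
      "\<forall>i<p. d i \<in> X (Suc n)" "inj_on d {..<p}"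
      "\<forall>i<p. \<not> has_grid n X {\<alpha> \<in> pattern k s b. \<alpha>(Suc n := d i) \<notin> Y} l"
      by (elim exE conjE) auto
    define E where "E = case_sum b (\<lambda>i. if i < p then d i else replicate (m (Suc n)) undefined)"
    have "length (E u) = \<sigma> u" for u
      using bd(1,3) length_X by (auto simp: E_def \<sigma>_def split: sum.splits)
    moreover have "Q t E" if "t < p" for t
      unfolding Q_def using that bd broad_imp_has_grid[OF bd(2)]
      by (auto simp: E_def inj_on_def)
    ultimately show "\<exists>E. (\<forall>u. length (E u) = \<sigma> u) \<and> (\<forall>t<p. Q t E)" by blast
  qed
  then obtain E where E: "\<And>u. length (E u) = \<sigma> u" "\<And>p. Q p E" by blast
  define W where "W = pattern k s (\<lambda>j. E (Inl j))"
  have W: "tuple_definable m (\<lambda>E. (\<lambda>i \<in> {1..n}. E i) \<in> W)"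
    unfolding W_def by (rule definable_family_instance[OF definable_family_pat]) (simp add: E(1) \<sigma>_def)
  moreover have "has_grid n X W p" for p
    using E(2)[of p] unfolding Q_def W_def by (elim conjE)
  then have "broad n X W" using broad_iff_has_grid[OF X' W] by blast
  ultimately have "finite {b \<in> X (Suc n). \<not> has_grid n X {\<alpha> \<in> W. \<alpha>(Suc n := b) \<notin> Y} l}"
    by (rule fin)
  moreover have "range (\<lambda>i. E (Inr i)) \<subseteq> {b \<in> X (Suc n). \<not> has_grid n X {\<alpha> \<in> W. \<alpha>(Suc n := b) \<notin> Y} l}"
    using E(2)[of "Suc _"] unfolding Q_def W_def by fastforce
  moreover have "inj (\<lambda>i. E (Inr i))"
  proof (rule injI)
    fix i j assume "E (Inr i) = E (Inr j)"
    then show "i = j" using E(2)[of "Suc (max i j)"] unfolding Q_def by (auto simp: less_Suc_eq_le)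
  qed
  ultimately show False
    using finite_subset range_inj_infinite by blast
qed

text \<open>This is where NIP enters, through \<open>shatter_bound\<close>. A fixed grid size
  \<open>l\<close>, rather than mere narrowness, later makes the last side of the box
  definable.\<close>

lemma ex_almost_constant_fibre:
  assumes broadY: "broad (Suc n) X Y"
  shows "\<exists>W l. tuple_definable m (\<lambda>E. (\<lambda>i \<in> {1..n}. E i) \<in> W) \<and> broad n X W \<and>
    infinite {b \<in> X (Suc n). \<not> has_grid n X {\<alpha> \<in> W. \<alpha>(Suc n := b) \<notin> Y} l}"
proof (rule ccontr)
  assume neg: "\<not> ?thesis"
  have fin: "finite {b \<in> X (Suc n). \<not> has_grid n X {\<alpha> \<in> W. \<alpha>(Suc n := b) \<notin> Y} l}"
    if "tuple_definable m (\<lambda>E. (\<lambda>i \<in> {1..n}. E i) \<in> W)" "broad n X W" for W l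
    using neg that by blast
  obtain N where N: "\<And>b. (\<And>j. j < N \<Longrightarrow> b j \<in> X (Suc n)) \<Longrightarrow> \<exists>s. pattern N s b = {}"
    using shatter_bound by blast
  obtain a :: "nat \<Rightarrow> nat \<Rightarrow> 'a list" where
    a: "\<forall>i \<in> {1..Suc n}. (\<forall>j. a i j \<in> X i) \<and> inj (a i)"
    and aY: "\<forall>\<eta> :: nat \<Rightarrow> nat. (\<lambda>i \<in> {1..Suc n}. a i (\<eta> i)) \<in> Y"
    using broadY unfolding broad_def by (elim exE conjE)
  define \<beta> where "\<beta> = a (Suc n)"
  have \<beta>: "\<beta> j \<in> X (Suc n)" "inj \<beta>" for j using a by (simp_all add: \<beta>_def)
  \<comment> \<open>A priori the omitted pattern depends on the tuple; Ramsey's theorem makes it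
    constant along a subsequence. Patterns restricted to \<open>{..<N}\<close> are finitely many
    colours.\<close>
  have "\<exists>h s. strict_mono h \<and> s \<in> Pi\<^sub>E {..<N} (\<lambda>_. UNIV :: bool set) \<and>
      (\<forall>f :: nat \<Rightarrow> nat. strict_mono_on {..<N} f \<longrightarrow> pattern N s (\<lambda>j. \<beta> (h (f j))) = {})"
  proof (rule increasing_Ramsey[where R = "\<lambda>s f. pattern N s (\<lambda>j. \<beta> (f j)) = {}"])
    show "finite (Pi\<^sub>E {..<N} (\<lambda>_. UNIV :: bool set))" by (intro finite_PiE) auto
  next
    fix f :: "nat \<Rightarrow> nat"
    have "\<exists>s. pattern N s (\<lambda>j. \<beta> (f j)) = {}" by (rule N) (rule \<beta>(1))
    then obtain s where "pattern N s (\<lambda>j. \<beta> (f j)) = {}" ..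
    moreover have "pattern N (restrict s {..<N}) (\<lambda>j. \<beta> (f j)) = pattern N s (\<lambda>j. \<beta> (f j))"
      by (rule pattern_cong) auto
    ultimately show "\<exists>s \<in> Pi\<^sub>E {..<N} (\<lambda>_. UNIV). pattern N s (\<lambda>j. \<beta> (f j)) = {}"
      by (intro bexI[of _ "restrict s {..<N}"]) auto
  next
    fix s and f g :: "nat \<Rightarrow> nat"
    assume "\<And>j. j < N \<Longrightarrow> f j = g j"
    then have "pattern N s (\<lambda>j. \<beta> (f j)) = pattern N s (\<lambda>j. \<beta> (g j))" by (intro pattern_cong) auto
    then show "(pattern N s (\<lambda>j. \<beta> (f j)) = {}) = (pattern N s (\<lambda>j. \<beta> (g j)) = {})" by simp
  qed
  then obtain h s where h: "strict_mono h"
    and miss: "\<And>f :: nat \<Rightarrow> nat. strict_mono_on {..<N} f \<Longrightarrow> pattern N s (\<lambda>j. \<beta> (h (f j))) = {}"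
    by blast
  \<comment> \<open>\<open>u q\<close> follows \<open>s\<close> below \<open>q\<close> and demands
    membership from \<open>q\<close> on: \<open>u 0\<close> is the full intersection, and
    \<open>u N\<close> agrees with \<open>s\<close> on \<open>{..<N}\<close>.\<close>
  define u where "u = (\<lambda>q j. q \<le> j \<or> s j)"
  define inc where "inc = (\<lambda>k :: nat. {f \<in> Pi\<^sub>E {..<N} (\<lambda>_. {..<k}). strict_mono_on {..<N} f})"
  \<comment> \<open>A subset of \<open>Pi\<^sub>E {1..n} X\<close> has a grid of size 1 iff it is nonempty.\<close>
  define conf where "conf = (\<lambda>k b. (\<forall>j \<in> {..<k}. b j \<in> X (Suc n)) \<and>
      (\<forall>i \<in> {..<k}. \<forall>j \<in> {..<k}. b i = b j \<longrightarrow> i = j) \<and>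
      (\<forall>f \<in> inc k. \<not> has_grid n X (pattern N s (\<lambda>j. b (f j))) 1))"
  \<comment> \<open>Passing to subsequences allows entries to be dropped in the insertion
    step.\<close>
  have conf_sub: "conf k (\<lambda>j. b (g j))"
    if b: "conf k' b" and g: "strict_mono_on {..<k} g" "\<And>j. j < k \<Longrightarrow> g j < k'" for k k' b g
  proof -
    have "\<not> has_grid n X (pattern N s (\<lambda>j. b (g (f j)))) 1" if f: "f \<in> inc k" for f
    proof -
      have fk: "f j < k" if "j < N" for j using f that by (auto simp: inc_def)
      have "restrict (\<lambda>j. g (f j)) {..<N} \<in> inc k'"
        using f fk g by (auto simp: inc_def strict_mono_on_def)
      then have "\<not> has_grid n X (pattern N s (\<lambda>j. b (restrict (\<lambda>j. g (f j)) {..<N} j))) 1"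
        using b unfolding conf_def by blast
      also have "pattern N s (\<lambda>j. b (restrict (\<lambda>j. g (f j)) {..<N} j)) = pattern N s (\<lambda>j. b (g (f j)))"
        by (rule pattern_cong) auto
      finally show ?thesis .
    qed
    moreover have "i = j" if "i < k" "j < k" "b (g i) = b (g j)" for i j
    proof -
      have "g i = g j" using b g(2) that unfolding conf_def by blast
      then show ?thesis using strict_mono_on_imp_inj_on[OF g(1)] that by (auto dest: inj_onD)
    qed
    ultimately show ?thesis using b g(2) unfolding conf_def by auto
  qed
  \<comment> \<open>\<open>C q k\<close> is carried along for every \<open>k\<close>, because each
    insertion uses up entries; the sequence \<open>b\<close> may change from stage to stage.\<close>
  define C where "C = (\<lambda>q k. \<exists>b. (\<forall>j. length (b j) = m (Suc n)) \<and> conf k b \<and> broad n X (pattern k (u q) b))"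
  have C_mono: "C q k" if "C q k'" "k \<le> k'" for q k k'
  proof -
    obtain b where b: "\<forall>j. length (b j) = m (Suc n)" "conf k' b" "broad n X (pattern k' (u q) b)"
      using \<open>C q k'\<close> unfolding C_def by blast
    have "conf k b" using conf_sub[OF b(2), of k "\<lambda>j. j"] that(2) by (auto simp: strict_mono_on_def)
    moreover have "broad n X (pattern k (u q) b)"
      by (rule broad_mono[OF b(3)]) (use that(2) in \<open>auto simp: pattern_def\<close>)
    ultimately show ?thesis unfolding C_def using b(1) by blast
  qed
  \<comment> \<open>The first \<open>n\<close> rows of the array witnessing that \<open>Y\<close> is
    broad lie in all fibres over the \<open>\<beta> j\<close>.\<close>
  have base: "C 0 k" for k
    unfolding C_def
  proof (intro exI[of _ "\<lambda>j. \<beta> (h j)"] conjI allI)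
    show "length (\<beta> (h j)) = m (Suc n)" for j using length_X[OF \<beta>(1)] by simp
    have "\<not> has_grid n X (pattern N s (\<lambda>j. \<beta> (h (f j)))) 1" if "f \<in> inc k" for f
    proof -
      have "pattern N s (\<lambda>j. \<beta> (h (f j))) = {}" using that by (intro miss) (simp add: inc_def)
      moreover have "(\<lambda>i \<in> {1..n}. 0) \<in> Pi\<^sub>E {1..n} (\<lambda>_. {..<1::nat})" by auto
      ultimately show ?thesis unfolding has_grid_def is_grid_def by blast
    qed
    then show "conf k (\<lambda>j. \<beta> (h j))"
      unfolding conf_def using \<beta> h by (auto dest: injD strict_mono_eq[THEN iffD1])
    show "broad n X (pattern k (u 0) (\<lambda>j. \<beta> (h j)))"
      unfolding broad_def
    proof (intro exI[of _ a] conjI allI)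
      show "\<forall>i \<in> {1..n}. (\<forall>j. a i j \<in> X i) \<and> inj (a i)" using a by auto
      fix \<eta> :: "nat \<Rightarrow> nat"
      have "(\<lambda>i \<in> {1..n}. a i (\<eta> i))(Suc n := \<beta> (h j)) \<in> Y" for j
      proof -
        have "(\<lambda>i \<in> {1..Suc n}. a i ((\<eta>(Suc n := h j)) i)) \<in> Y" using aY by (rule spec)
        also have "(\<lambda>i \<in> {1..Suc n}. a i ((\<eta>(Suc n := h j)) i)) = (\<lambda>i \<in> {1..n}. a i (\<eta> i))(Suc n := \<beta> (h j))"
          unfolding restrict_upd by (rule restrict_ext) (simp add: \<beta>_def)
        finally show ?thesis .
      qed
      then show "(\<lambda>i \<in> {1..n}. a i (\<eta> i)) \<in> pattern k (u 0) (\<lambda>j. \<beta> (h j))"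
        using a by (auto simp: pattern_def u_def)
    qed
  qed
  have step: "C (Suc q) k" if all: "\<And>k. C q k" for q k
  proof (cases "s q")
    case True
    then have "u (Suc q) = u q" by (auto simp: u_def fun_eq_iff not_less_eq_eq le_Suc_eq) (metis le_antisym not_less_eq_eq)
    then show ?thesis using all[of k] by (simp add: C_def)
  next
    case False
    \<comment> \<open>With \<open>q \<le> k1\<close>, position \<open>q\<close> exists among the
      \<open>Suc k1\<close> entries after insertion.\<close>
    define k1 where "k1 = max k q"
    define \<sigma> where "\<sigma> = (\<lambda>_ :: nat. m (Suc n))"
    \<comment> \<open>The inserted entry depends on the grid size \<open>l\<close>; saturation
      yields one sequence for all \<open>l\<close>, hence broadness.\<close>
    have "\<exists>b. (\<forall>j. length (b j) = \<sigma> j) \<and>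
        (\<forall>l. conf (Suc k1) b \<and> has_grid n X (pattern (Suc k1) (u (Suc q)) b) l)"
    proof (rule tuple_saturation)
      have 1: "definable_family \<sigma> m n (\<lambda>b. pattern N s (\<lambda>j. b (f j)))" for f
        unfolding definable_family_def
        using tuple_definable_rename[OF definable_family_pat[unfolded definable_family_def], where h = "case_sum (\<lambda>w. Inl (f w)) Inr" and s = "case_sum \<sigma> m"]
        by (simp add: \<sigma>_def split: sum.splits)
      have "finite (inc k)" for k
        unfolding inc_def by (intro finite_Collect_conjI disjI1 finite_PiE[unfolded PiE_def]) (auto intro: finite_PiE)
      then have "tuple_definable \<sigma> (conf k)" for k
        unfolding conf_def
        by (intro tuple_definable_conj tuple_definable_ball tuple_definable_imp tuple_definable_neg tuple_definable_const tuple_definable_has_grid[OF X' 1]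
            tuple_definable_definable tuple_definable_eq) (simp_all add: \<sigma>_def X)
      then show "tuple_definable \<sigma> (\<lambda>b. conf (Suc k1) b \<and> has_grid n X (pattern (Suc k1) (u (Suc q)) b) l)" for l
        by (intro tuple_definable_conj tuple_definable_has_grid[OF X' definable_family_pat[folded \<sigma>_def]])
    next
      fix l
      \<comment> \<open>The bound \<open>p\<close> is fixed before the sequence, which can then be
        taken with \<open>p\<close> spare entries.\<close>
      obtain p :: nat where p: "\<And>b d. \<lbrakk>\<forall>j. length (b j) = m (Suc n); broad n X (pattern k1 (u q) b);
          \<forall>i<p. d i \<in> X (Suc n); inj_on d {..<p}\<rbrakk> \<Longrightarrow>
          \<exists>i<p. has_grid n X {\<alpha> \<in> pattern k1 (u q) b. \<alpha>(Suc n := d i) \<notin> Y} l"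
      proof -
        have "\<exists>p :: nat. \<forall>b d. (\<forall>j. length (b j) = m (Suc n)) \<and> broad n X (pattern k1 (u q) b) \<and>
            (\<forall>i<p. d i \<in> X (Suc n)) \<and> inj_on d {..<p} \<longrightarrow>
            (\<exists>i<p. has_grid n X {\<alpha> \<in> pattern k1 (u q) b. \<alpha>(Suc n := d i) \<notin> Y} l)"
          by (rule uniform_gap_bound) (rule fin)
        then show ?thesis using that by blast
      qed
      obtain b where b: "\<forall>j. length (b j) = m (Suc n)" "conf (k1 + p) b" "broad n X (pattern (k1 + p) (u q) b)"
        using all[of "k1 + p"] unfolding C_def by blast
      \<comment> \<open>The \<open>p\<close> entries of \<open>b\<close> at \<open>q, \<dots>, q + p - 1\<close> are left out of \<open>b'\<close>; one of them can be inserted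
        as a fibre to be avoided.\<close>
      define b' where "b' = (\<lambda>j. b (if j < q then j else j + p))"
      \<comment> \<open>From \<open>q\<close> on, \<open>u q\<close> only asks for membership, so
        deleting entries there and shifting the rest is harmless.\<close>
      have sub: "pattern (k1 + p) (u q) b \<subseteq> pattern k1 (u q) b'"
        by (auto simp: pattern_def b'_def u_def)
      obtain i where i: "i < p" "has_grid n X {\<alpha> \<in> pattern k1 (u q) b'. \<alpha>(Suc n := b (q + i)) \<notin> Y} l"
      proof -
        have "q + i < k1 + p" if "i < p" for i using that by (simp add: k1_def)
        then have "\<forall>i<p. b (q + i) \<in> X (Suc n)" "inj_on (\<lambda>i. b (q + i)) {..<p}"
          using b(2) unfolding conf_def inj_on_def
          by (simp, metis add_left_cancel lessThan_iff)
        then show ?thesis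
          using p[of b' "\<lambda>i. b (q + i)"] b(1) broad_mono[OF b(3) sub] that by (auto simp: b'_def)
      qed
      \<comment> \<open>Positions in \<open>b\<close>: those before \<open>q\<close>, the inserted
        \<open>q + i\<close>, then the rest of \<open>b'\<close> moved up by one place, whence
        \<open>j - 1\<close>.\<close>
      define g where "g = (\<lambda>j. if j < q then j else if j = q then q + i else j - 1 + p)"
      have "strict_mono_on {..<Suc k1} g"
        using i(1) by (auto simp: strict_mono_on_def g_def)
      moreover have "g j < k1 + p" if "j < Suc k1" for j
        using that i(1) by (auto simp: g_def k1_def)
      ultimately have conf: "conf (Suc k1) (\<lambda>j. b (g j))" by (rule conf_sub[OF b(2)])
      have "\<alpha> \<in> pattern (Suc k1) (u (Suc q)) (\<lambda>j. b (g j))"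
        if \<alpha>: "\<alpha> \<in> pattern k1 (u q) b'" "\<alpha>(Suc n := b (q + i)) \<notin> Y" for \<alpha>
      proof -
        have "(\<alpha>(Suc n := b (g j)) \<in> Y) = u (Suc q) j" if "j < Suc k1" for j
        proof -
          consider "j < q" | "j = q" | "q < j" by linarith
          then show ?thesis
          proof cases
            case 1
            then have "j < k1" by (simp add: k1_def)
            then have "(\<alpha>(Suc n := b' j) \<in> Y) = u q j" using \<alpha>(1) by (simp add: pattern_def)
            then show ?thesis using 1 by (simp add: b'_def g_def u_def)
          next
            case 2
            then show ?thesis using \<alpha>(2) False by (simp add: g_def u_def)
          next
            case 3
            then obtain i where j: "j = Suc i" "q \<le> i" "i < k1" using \<open>j < Suc k1\<close> by (cases j) auto
            then have "(\<alpha>(Suc n := b' i) \<in> Y) = u q i" using \<alpha>(1) by (simp add: pattern_def)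
            then show ?thesis using j(2) by (simp add: j(1) b'_def g_def u_def)
          qed
        qed
        then show ?thesis using \<alpha>(1) by (simp add: pattern_def)
      qed
      then have "{\<alpha> \<in> pattern k1 (u q) b'. \<alpha>(Suc n := b (q + i)) \<notin> Y} \<subseteq> pattern (Suc k1) (u (Suc q)) (\<lambda>j. b (g j))"
        by blast
      then have "has_grid n X (pattern (Suc k1) (u (Suc q)) (\<lambda>j. b (g j))) t" if "t < l" for t
        using has_grid_mono[OF i(2)] that by simp
      then show "\<exists>b. (\<forall>j. length (b j) = \<sigma> j) \<and>
          (\<forall>t<l. conf (Suc k1) b \<and> has_grid n X (pattern (Suc k1) (u (Suc q)) b) t)"
        using b(1) conf by (intro exI[of _ "\<lambda>j. b (g j)"]) (simp add: \<sigma>_def)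
    qed
    then obtain b where b: "\<And>j. length (b j) = m (Suc n)" "conf (Suc k1) b"
      "\<forall>l. has_grid n X (pattern (Suc k1) (u (Suc q)) b) l"
      unfolding \<sigma>_def by blast
    have W: "tuple_definable m (\<lambda>E. (\<lambda>i \<in> {1..n}. E i) \<in> pattern (Suc k1) (u (Suc q)) b)"
      by (rule definable_family_instance[OF definable_family_pat b(1)])
    have "broad n X (pattern (Suc k1) (u (Suc q)) b)"
      using broad_iff_has_grid[OF X' W] b(3) by blast
    then have "C (Suc q) (Suc k1)" unfolding C_def using b(1,2) by blast
    then show ?thesis by (rule C_mono) (simp add: k1_def)
  qed
  have "\<forall>k. C q k" for q by (induction q) (use base step in auto)
  \<comment> \<open>For \<open>q = N\<close> the broad pattern is \<open>s\<close> itself, which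
    \<open>conf\<close> forbids for the identity tuple.\<close>
  then have "C N N" by blast
  then obtain b where b: "conf N b" "broad n X (pattern N (u N) b)" unfolding C_def by blast
  have "restrict (\<lambda>j. j) {..<N} \<in> inc N" by (auto simp: inc_def strict_mono_on_def)
  then have "\<not> has_grid n X (pattern N s (\<lambda>j. b (restrict (\<lambda>j. j) {..<N} j))) 1"
    using b(1) unfolding conf_def by blast
  also have "pattern N s (\<lambda>j. b (restrict (\<lambda>j. j) {..<N} j)) = pattern N (u N) b"
    by (rule pattern_cong) (auto simp: u_def)
  finally show False using broad_imp_has_grid[OF b(2)] by blast
qed

end

section \<open>Hyperplanes\<close>

text \<open>Fixing the last coordinate at one entry of its row leaves a grid in a single fibre.
  Constant choice functions show that all entries lie in the sides \<open>D i\<close>.\<close>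

lemma broad_fibre:
  fixes X :: "nat \<Rightarrow> 'b set"
  assumes "broad (Suc n) X H" "H \<subseteq> Pi\<^sub>E {1..Suc n} D"
  shows "\<exists>b \<in> D (Suc n). broad n X {\<alpha> \<in> Pi\<^sub>E {1..n} D. \<alpha>(Suc n := b) \<in> H}"
proof -
  obtain a :: "nat \<Rightarrow> nat \<Rightarrow> 'b" where
    a: "\<forall>i \<in> {1..Suc n}. (\<forall>j. a i j \<in> X i) \<and> inj (a i)"
    and aH: "\<forall>\<eta> :: nat \<Rightarrow> nat. (\<lambda>i \<in> {1..Suc n}. a i (\<eta> i)) \<in> H"
    using assms(1) unfolding broad_def by (elim exE conjE)
  have D: "a i j \<in> D i" if "i \<in> {1..Suc n}" for i j
  proof -
    have "(\<lambda>i \<in> {1..Suc n}. a i j) \<in> H" using aH[rule_format, of "\<lambda>_. j"] .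
    with assms(2) have "(\<lambda>i \<in> {1..Suc n}. a i j) \<in> Pi\<^sub>E {1..Suc n} D" by (rule subsetD)
    from PiE_mem[OF this that] show ?thesis using that by simp
  qed
  have "(\<lambda>i \<in> {1..n}. a i (\<eta> i))(Suc n := a (Suc n) 0) \<in> H" for \<eta>
  proof -
    have "(\<lambda>i \<in> {1..Suc n}. a i ((\<eta>(Suc n := 0)) i)) \<in> H" using aH by (rule spec)
    also have "(\<lambda>i \<in> {1..Suc n}. a i ((\<eta>(Suc n := 0)) i)) = (\<lambda>i \<in> {1..n}. a i (\<eta> i))(Suc n := a (Suc n) 0)"
      unfolding restrict_upd by (rule restrict_ext) simp
    finally show ?thesis .
  qed
  then have "broad n X {\<alpha> \<in> Pi\<^sub>E {1..n} D. \<alpha>(Suc n := a (Suc n) 0) \<in> H}"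
    unfolding broad_def using a D by (intro exI[of _ a]) auto
  then show ?thesis using D[of "Suc n" 0] by auto
qed

lemma broad_PiE:
  assumes "\<And>i. i \<in> {1..n} \<Longrightarrow> D i \<subseteq> X i \<and> infinite (D i)"
  shows "broad n X (Pi\<^sub>E {1..n} D)"
proof -
  have "\<exists>f :: nat \<Rightarrow> _. i \<in> {1..n} \<longrightarrow> inj f \<and> range f \<subseteq> D i" for i
    using assms infinite_countable_subset by blast
  then obtain a :: "nat \<Rightarrow> nat \<Rightarrow> _" where "\<And>i. i \<in> {1..n} \<Longrightarrow> inj (a i) \<and> range (a i) \<subseteq> D i"
    by metis
  then have a: "inj (a i)" "a i j \<in> D i" if "i \<in> {1..n}" for i j using that by blast+
  show ?thesis
    unfolding broad_def
  proof (intro exI[of _ a] conjI ballI allI)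
    show "a i j \<in> X i" if "i \<in> {1..n}" for i j using a(2)[OF that] assms[OF that] by blast
    show "(\<lambda>i \<in> {1..n}. a i (\<eta> i)) \<in> Pi\<^sub>E {1..n} D" for \<eta> using a(2) by simp
  qed (rule a(1))
qed

context definable_relation
begin

lemma tuple_definable_PiE_diff:
  assumes "\<And>i. i \<in> {1..Suc n} \<Longrightarrow> definable L M (m i) (D i)"
  shows "tuple_definable m (\<lambda>E. (\<lambda>i \<in> {1..Suc n}. E i) \<in> Pi\<^sub>E {1..Suc n} D - Y)"
proof -
  have "tuple_definable m (\<lambda>E. \<forall>i \<in> {1..Suc n}. E i \<in> D i)"
    by (intro tuple_definable_ball tuple_definable_definable finite_atLeastAtMost) (simp add: assms)
  then have "tuple_definable m (\<lambda>E. (\<lambda>i \<in> {1..Suc n}. E i) \<in> Pi\<^sub>E {1..Suc n} D)"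
    by (simp add: Ball_def Pi_iff)
  then show ?thesis unfolding Diff_iff by (intro tuple_definable_conj tuple_definable_neg Y)
qed

text \<open>This serves both directions: in the induction it makes the box minus \<open>W\<close>
  narrow.\<close>

lemma narrow_hyperplane:
  assumes "\<And>b. b \<in> D (Suc n) \<Longrightarrow> narrow n X {\<alpha> \<in> Pi\<^sub>E {1..n} D. \<alpha>(Suc n := b) \<notin> Y}"
  shows "narrow (Suc n) X (Pi\<^sub>E {1..Suc n} D - Y)"
proof
  assume "broad (Suc n) X (Pi\<^sub>E {1..Suc n} D - Y)"
  then obtain b where "b \<in> D (Suc n)"
    "broad n X {\<alpha> \<in> Pi\<^sub>E {1..n} D. \<alpha>(Suc n := b) \<in> Pi\<^sub>E {1..Suc n} D - Y}"
    using broad_fibre[of n X "Pi\<^sub>E {1..Suc n} D - Y" D] by blast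
  moreover have "{\<alpha> \<in> Pi\<^sub>E {1..n} D. \<alpha>(Suc n := b) \<in> Pi\<^sub>E {1..Suc n} D - Y}
      \<subseteq> {\<alpha> \<in> Pi\<^sub>E {1..n} D. \<alpha>(Suc n := b) \<notin> Y}" by blast
  ultimately show False using assms broad_mono by blast
qed

text \<open>The box has grids of every size and is covered by \<open>Y\<close> and the hyperplane.
  The latter omits grids of size \<open>k0\<close>, so by \<open>has_grid_Un\<close> they occur in
  \<open>Y\<close>.\<close>

lemma broad_if_hyperplane:
  assumes D: "\<And>i. i \<in> {1..Suc n} \<Longrightarrow> D i \<subseteq> X i \<and> infinite (D i) \<and> definable L M (m i) (D i)"
    and narrow: "\<And>b. b \<in> D (Suc n) \<Longrightarrow> narrow n X {\<alpha> \<in> Pi\<^sub>E {1..n} D. \<alpha>(Suc n := b) \<notin> Y}"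
  shows "broad (Suc n) X Y"
proof -
  let ?H = "Pi\<^sub>E {1..Suc n} D - Y"
  have H: "tuple_definable m (\<lambda>E. (\<lambda>i \<in> {1..Suc n}. E i) \<in> ?H)" by (rule tuple_definable_PiE_diff) (use D in blast)
  have "narrow (Suc n) X ?H" using narrow by (rule narrow_hyperplane)
  then obtain k0 where k0: "\<not> has_grid (Suc n) X ?H k0"
    using broad_iff_has_grid[OF X H] by blast
  have "has_grid (Suc n) X Y k" for k
  proof -
    obtain R where R: "has_grid (Suc n) X (?H \<union> Y) R \<Longrightarrow>
        has_grid (Suc n) X ?H (max k k0) \<or> has_grid (Suc n) X Y (max k k0)"
      using has_grid_Un[of "Suc n" "max k k0"] by blast
    have "broad (Suc n) X (Pi\<^sub>E {1..Suc n} D)" by (rule broad_PiE) (use D in blast)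
    then have "has_grid (Suc n) X (?H \<union> Y) R"
      by (rule broad_imp_has_grid[OF broad_mono]) blast
    then show ?thesis using R k0 has_grid_mono[of "Suc n" X] by (meson max.cobounded1 max.cobounded2 order_refl)
  qed
  then show ?thesis using broad_iff_has_grid[OF X Y] by blast
qed

end

context nip_structure
begin

text \<open>\<open>Y\<close> varies in the induction, since the hypothesis is applied to the set
  \<open>W\<close> from \<open>ex_almost_constant_fibre\<close>; it yields all sides but the
  last.\<close>

lemma hyperplane_if_broad:
  assumes "\<And>i. i \<in> {1..Suc n} \<Longrightarrow> definable L M (m i) (X i)"
    and "tuple_definable m (\<lambda>E. (\<lambda>i \<in> {1..Suc n}. E i) \<in> Y)" and "broad (Suc n) X Y"
  shows "\<exists>D. (\<forall>i \<in> {1..Suc n}. D i \<subseteq> X i \<and> infinite (D i) \<and> definable L M (m i) (D i)) \<and>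
    (\<forall>b \<in> D (Suc n). narrow n X {\<alpha> \<in> Pi\<^sub>E {1..n} D. \<alpha>(Suc n := b) \<notin> Y})"
  using assms
proof (induction n arbitrary: Y)
  let ?good = "\<lambda>n D. \<forall>i \<in> {1..n}. D i \<subseteq> X i \<and> infinite (D i) \<and> definable L M (m i) (D i)"
  \<comment> \<open>The box minus a fibre of \<open>Y\<close> is covered by the box minus
    \<open>W\<close> and \<open>W\<close> minus the fibre. Both omit grids of fixed sizes, so the
    union omits those of size \<open>R\<close>, uniformly in \<open>b\<close>.\<close>
  have extend: "\<exists>D. ?good (Suc n) D \<and>
      (\<forall>b \<in> D (Suc n). narrow n X {\<alpha> \<in> Pi\<^sub>E {1..n} D. \<alpha>(Suc n := b) \<notin> Y})"
    if rel: "definable_relation L \<kappa> M n m X Y" and D': "?good n D'"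
      and k: "\<not> has_grid n X (Pi\<^sub>E {1..n} D' - W) k"
      and inf: "infinite {b \<in> X (Suc n). \<not> has_grid n X {\<alpha> \<in> W. \<alpha>(Suc n := b) \<notin> Y} l}"
    for n Y D' W k l
  proof -
    interpret definable_relation L \<kappa> M n m X Y by (rule rel)
    let ?F = "\<lambda>b. {\<alpha> \<in> Pi\<^sub>E {1..n} D'. \<alpha>(Suc n := b) \<notin> Y}"
    obtain R where R: "\<And>W W'. has_grid n X (W \<union> W') R \<Longrightarrow>
        has_grid n X W (max k l) \<or> has_grid n X W' (max k l)"
      using has_grid_Un[of n "max k l"] by blast
    \<comment> \<open>Omitting grids of the fixed size \<open>R\<close> is definable in
      \<open>b\<close> and implies narrowness.\<close>
    define Dn where "Dn = {b \<in> X (Suc n). \<not> has_grid n X (?F b) R}"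
    have "\<not> has_grid n X (?F b) R" if "\<not> has_grid n X {\<alpha> \<in> W. \<alpha>(Suc n := b) \<notin> Y} l" for b
    proof
      assume "has_grid n X (?F b) R"
      then have "has_grid n X ((Pi\<^sub>E {1..n} D' - W) \<union> {\<alpha> \<in> W. \<alpha>(Suc n := b) \<notin> Y}) R"
        by (rule has_grid_mono) auto
      from R[OF this] show False
        using k that has_grid_mono[of n X] by (meson max.cobounded1 max.cobounded2 order_refl)
    qed
    then have "{b \<in> X (Suc n). \<not> has_grid n X {\<alpha> \<in> W. \<alpha>(Suc n := b) \<notin> Y} l} \<subseteq> Dn"
      unfolding Dn_def by blast
    then have "infinite Dn" using inf finite_subset by blast
    have PD': "tuple_definable m (\<lambda>E. (\<lambda>i \<in> {1..n}. E i) \<in> Pi\<^sub>E {1..n} D')"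
      by (rule tuple_definable_PiE) (use D' in auto)
    have "definable_family (\<lambda>_ :: unit. m (Suc n)) m n (\<lambda>E. ?F (E ()))"
      by (rule definable_family_diff[OF definable_family_const[OF PD'], where g = "\<lambda>u. u"]) simp_all
    then have "tuple_definable (\<lambda>_ :: unit. m (Suc n)) (\<lambda>E. E () \<in> X (Suc n) \<and> \<not> has_grid n X (?F (E ())) R)"
      by (intro tuple_definable_conj tuple_definable_neg tuple_definable_definable tuple_definable_has_grid[OF X']) (simp_all add: X)
    then have "definable L M (m (Suc n)) {b. length b = m (Suc n) \<and> b \<in> X (Suc n) \<and> \<not> has_grid n X (?F b) R}"
      by (rule definable_if_tuple_definable)
    also have "{b. length b = m (Suc n) \<and> b \<in> X (Suc n) \<and> \<not> has_grid n X (?F b) R} = Dn"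
      using length_X unfolding Dn_def by auto
    finally have "definable L M (m (Suc n)) Dn" .
    define D where "D = D'(Suc n := Dn)"
    have "Pi\<^sub>E {1..n} D = Pi\<^sub>E {1..n} D'" by (rule PiE_cong) (simp add: D_def)
    moreover have "narrow n X (?F b)" if "b \<in> Dn" for b
      using that broad_imp_has_grid[of n X "?F b" R] unfolding Dn_def by blast
    ultimately have "\<forall>b \<in> D (Suc n). narrow n X {\<alpha> \<in> Pi\<^sub>E {1..n} D. \<alpha>(Suc n := b) \<notin> Y}"
      by (simp add: D_def del: fun_upd_apply add: fun_upd_same)
    moreover have "Dn \<subseteq> X (Suc n)" by (auto simp: Dn_def)
    then have "?good (Suc n) D"
      using D' \<open>infinite Dn\<close> \<open>definable L M (m (Suc n)) Dn\<close>
      by (auto simp: D_def le_Suc_eq)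
    ultimately show ?thesis by blast
  qed
  {
    case 0
    then have rel: "definable_relation L \<kappa> M 0 m X Y"
      by unfold_locales
    then interpret definable_relation L \<kappa> M 0 m X Y .
    obtain W l where W: "broad 0 X W"
      "infinite {b \<in> X (Suc 0). \<not> has_grid 0 X {\<alpha> \<in> W. \<alpha>(Suc 0 := b) \<notin> Y} l}"
      using ex_almost_constant_fibre[OF 0(3)] by blast
    \<comment> \<open>A broad \<open>W\<close> contains the only point, so the difference is empty
      and has no grid even of size \<open>0\<close>.\<close>
    have k: "\<not> has_grid 0 X (Pi\<^sub>E {1..0} X - W) 0"
      using W(1) by (simp add: has_grid_def is_grid_def broad_def restrict_def)
    have good: "?good 0 X" by simp
    from extend[OF rel good k W(2)] show ?case .
  next
    case (Suc n)
    then have rel: "definable_relation L \<kappa> M (Suc n) m X Y"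
      by unfold_locales
    then interpret definable_relation L \<kappa> M "Suc n" m X Y .
    obtain W l where W: "tuple_definable m (\<lambda>E. (\<lambda>i \<in> {1..Suc n}. E i) \<in> W)" "broad (Suc n) X W"
      "infinite {b \<in> X (Suc (Suc n)). \<not> has_grid (Suc n) X {\<alpha> \<in> W. \<alpha>(Suc (Suc n) := b) \<notin> Y} l}"
      using ex_almost_constant_fibre[OF Suc.prems(3)] by blast
    obtain D where D: "?good (Suc n) D"
      "\<forall>b \<in> D (Suc n). narrow n X {\<alpha> \<in> Pi\<^sub>E {1..n} D. \<alpha>(Suc n := b) \<notin> W}"
      using Suc.IH[OF X' W(1,2)] by blast
    interpret W: definable_relation L \<kappa> M n m X W
      by unfold_locales (use Suc.prems(1) W(1) in auto)
    have "narrow (Suc n) X (Pi\<^sub>E {1..Suc n} D - W)"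
      by (rule W.narrow_hyperplane) (use D(2) in blast)
    moreover have H: "tuple_definable m (\<lambda>E. (\<lambda>i \<in> {1..Suc n}. E i) \<in> Pi\<^sub>E {1..Suc n} D - W)"
      by (rule W.tuple_definable_PiE_diff) (use D(1) in blast)
    ultimately obtain k where k: "\<not> has_grid (Suc n) X (Pi\<^sub>E {1..Suc n} D - W) k"
      using broad_iff_has_grid[OF W.X H] by blast
    from extend[OF rel D(1) k W(3)] show ?case .
  }
qed

end

theorem theorem3p9:
  fixes L :: "('f, 'r) language"
    and T :: "('f, 'r) fm set"
    and \<kappa> :: "'k rel"
    and M :: "('f, 'r, 'a) struct"
    and n :: nat
    and m :: "nat \<Rightarrow> nat"
    and X :: "nat \<Rightarrow> 'a list set"
    and Y :: "(nat \<Rightarrow> 'a list) set"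
  assumes "monster_model L T \<kappa> M"
    and "NIP TYPE('a) L T"
    and "n \<ge> 1"
    and "\<And>i. i \<in> {1..n} \<Longrightarrow> definable L M (m i) (X i)"
    and "Y \<subseteq> Pi\<^sub>E {1..n} X"
    and "definable_in_prod L M n m Y"
  shows "broad n X Y \<longleftrightarrow>
    (\<exists>D :: nat \<Rightarrow> 'a list set.
       (\<forall>i \<in> {1..n}. D i \<subseteq> X i \<and> infinite (D i) \<and> definable L M (m i) (D i)) \<and>
       (\<forall>b \<in> D n. narrow (n - 1) X {a \<in> Pi\<^sub>E {1..n - 1} D. a(n := b) \<notin> Y}))"
proof -
  obtain n' where n: "n = Suc n'" using assms(3) by (cases n) auto
  \<comment> \<open>The monster is itself a model of \<open>T\<close>, so NIP applies to formulas
    evaluated in \<open>M\<close>.\<close>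
  have "\<forall>s \<in> T. holds M s []"
    using assms(1) by (auto simp: monster_model_def Th_def)
  then have "\<not> has_IP M p k l" if "p \<in> fms L (k + l)" for p k l
    using assms(2) that unfolding NIP_def by blast
  then interpret nip_structure L \<kappa> M
    using assms(1) by unfold_locales (auto simp: monster_model_def)
  have "tuple_definable m (\<lambda>E. (\<lambda>i \<in> {1..n}. E i) \<in> Y)"
  proof (rule tuple_definable_prod[OF assms(6)])
    show "Y \<subseteq> extensional {1..n}" using assms(5) by (auto simp: PiE_def)
    fix f i assume "f \<in> Y" "i \<in> {1..n}"
    then have "f i \<in> X i" using assms(5) by (blast intro: PiE_mem)
    then show "length (f i) = m i"
      using assms(4)[OF \<open>i \<in> {1..n}\<close>] by (auto simp: definable_def)
  qed
  note tuple_definable = this[unfolded n]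
  interpret definable_relation L \<kappa> M n' m X Y
    by unfold_locales (use assms(4) tuple_definable in \<open>auto simp: n\<close>)
  show ?thesis
    unfolding n diff_Suc_1
  proof
    assume "broad (Suc n') X Y"
    then show "\<exists>D. (\<forall>i \<in> {1..Suc n'}. D i \<subseteq> X i \<and> infinite (D i) \<and> definable L M (m i) (D i)) \<and>
       (\<forall>b \<in> D (Suc n'). narrow n' X {a \<in> Pi\<^sub>E {1..n'} D. a(Suc n' := b) \<notin> Y})"
      by (intro hyperplane_if_broad X Y)
  next
    assume "\<exists>D. (\<forall>i \<in> {1..Suc n'}. D i \<subseteq> X i \<and> infinite (D i) \<and> definable L M (m i) (D i)) \<and>
       (\<forall>b \<in> D (Suc n'). narrow n' X {a \<in> Pi\<^sub>E {1..n'} D. a(Suc n' := b) \<notin> Y})"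
    then obtain D where "\<And>i. i \<in> {1..Suc n'} \<Longrightarrow> D i \<subseteq> X i \<and> infinite (D i) \<and> definable L M (m i) (D i)"
      "\<And>b. b \<in> D (Suc n') \<Longrightarrow> narrow n' X {a \<in> Pi\<^sub>E {1..n'} D. a(Suc n' := b) \<notin> Y}"
      by blast
    then show "broad (Suc n') X Y" by (rule broad_if_hyperplane)
  qed
qed

end
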